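(* Let $\mathcal{D}=\{\mathcal{D}_n\}_{n\in\mathbb{N}}$ be a property of distributions such that each $\mathcal{D}_n$ is closed under mapping, and suppose that $\mathcal{D}$ is testable with sample complexity $s(n,\epsilon)$ in the standard distribution-testing model. Then $\mathcal{D}$ is testable in the DoHO model with query complexity $\widetilde{O}(\epsilon^{-1}\cdot s(n,\epsilon/2))$. Furthermore, the resulting tester uses $3\cdot s(n,\epsilon/2)$ samples, makes the same $O(\epsilon^{-1}\log(s(n,\epsilon/2)/\epsilon))$ uniformly distributed queries to each sample, and if the original tester has one-sided error then so does the resulting tester.
   Context: For $x,y\in\{0,1\}^n$ let $\Delta_H(x,y)=\frac1n|\{i\in[n]:x_i\neq y_i\}|$. For distributions $P,Q$ over $\{0,1\}^n$, their distance is the optimal value of $\min\sum_{x,y}w_{x,y}\Delta_H(x,y)$ over nonnegative $w_{x,y}$ with $\sum_y w_{x,y}=P(x)$ for all $x$ and $\sum_x w_{x,y}=Q(y)$ for all $y$ (earth mover's distance under relative Hamming distance); $P$ is $\epsilon$-close to $Q$ if this is at most $\epsilon$ and $\epsilon$-far otherwise; $P$ is $\epsilon$-far from a set of distributions if it is $\epsilon$-far from each member. A property of distributions is $\mathcal{D}=\{\mathcal{D}_n\}$ with $\mathcal{D}_n$ a set of distributions over $\{0,1\}^n$. A tester in the DoHO model of sample complexity $s$ is a probabilistic machine that, on input $n,\epsilon$ and oracle access to $s(n,\epsilon)$ samples drawn independently from an unknown distribution $P$ over $\{0,1\}^n$ (it may query individual bits of each sample), accepts with probability at least $2/3$ if $P\in\mathcal{D}_n$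 and rejects with probability at least $2/3$ if $P$ is $\epsilon$-far from $\mathcal{D}_n$; its query complexity is the maximum total number of bit queries it makes; it has one-sided error if it accepts every $P\in\mathcal{D}_n$ with probability 1. In the standard distribution-testing model, the tester receives the samples in full and "far" refers to total variation distance; its sample complexity is the number of samples. $\mathcal{D}_n$ is closed under mapping if for every $f:\{0,1\}^n\to\{0,1\}^n$ and every distribution $X$ in $\mathcal{D}_n$, the distribution $f(X)$ (i.e., $\Pr[f(X)=y]=\Pr[X\in f^{-1}(y)]$) is in $\mathcal{D}_n$. *)

theory Defs
  imports "HOL-Probability.Probability"
begin

section \<open>Distributions over bit strings and their distances\<close>

definition cube :: "nat \<Rightarrow> bool list set" where
  "cube n = {x. length x = n}"

definition distributions :: "nat \<Rightarrow> bool list pmf set" where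
  "distributions n = {P. set_pmf P \<subseteq> cube n}"

definition rel_hamming :: "nat \<Rightarrow> bool list \<Rightarrow> bool list \<Rightarrow> real" where
  "rel_hamming n x y = real (card {i. i < n \<and> x ! i \<noteq> y ! i}) / real n"

definition transport_plans ::
    "nat \<Rightarrow> bool list pmf \<Rightarrow> bool list pmf \<Rightarrow> (bool list \<Rightarrow> bool list \<Rightarrow> real) set" where
  "transport_plans n P Q =
     {w. (\<forall>x\<in>cube n. \<forall>y\<in>cube n. w x y \<ge> 0) \<and>
         (\<forall>x\<in>cube n. (\<Sum>y\<in>cube n. w x y) = pmf P x) \<and>
         (\<forall>y\<in>cube n. (\<Sum>x\<in>cube n. w x y) = pmf Q y)}"

text \<open>Earth mover's distance. For \<open>P, Q \<in> distributions n\<close> the set of costs is nonempty and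
  the infimum is attained.\<close>

definition emd :: "nat \<Rightarrow> bool list pmf \<Rightarrow> bool list pmf \<Rightarrow> real" where
  "emd n P Q =
     (INF w\<in>transport_plans n P Q. \<Sum>x\<in>cube n. \<Sum>y\<in>cube n. w x y * rel_hamming n x y)"

definition tv_dist :: "nat \<Rightarrow> bool list pmf \<Rightarrow> bool list pmf \<Rightarrow> real" where
  "tv_dist n P Q = (\<Sum>x\<in>cube n. \<bar>pmf P x - pmf Q x\<bar>) / 2"

definition far_from ::
    "(bool list pmf \<Rightarrow> bool list pmf \<Rightarrow> real) \<Rightarrow> real \<Rightarrow> bool list pmf \<Rightarrow> bool list pmf set \<Rightarrow> bool" where
  "far_from d \<epsilon> P S \<longleftrightarrow> (\<forall>Q\<in>S. d P Q > \<epsilon>)"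


section \<open>Properties of distributions\<close>

text \<open>Throughout, the string length is \<open>n \<ge> 1\<close> and the proximity parameter is
  \<open>\<epsilon> \<in> {0<..1}\<close>; both distances above are at most \<open>1\<close>.\<close>

definition distribution_property :: "(nat \<Rightarrow> bool list pmf set) \<Rightarrow> bool" where
  "distribution_property D \<longleftrightarrow> (\<forall>n\<ge>1. D n \<subseteq> distributions n)"

definition closed_under_mapping :: "nat \<Rightarrow> bool list pmf set \<Rightarrow> bool" where
  "closed_under_mapping n S \<longleftrightarrow> (\<forall>f\<in>cube n \<rightarrow> cube n. \<forall>X\<in>S. map_pmf f X \<in> S)"


section \<open>The standard model\<close>

text \<open>A tester maps \<open>n\<close>, \<open>\<epsilon>\<close> and the list of samples to the distribution of its verdict
  (\<open>True\<close> means accept).\<close>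

type_synonym std_machine = "nat \<Rightarrow> real \<Rightarrow> bool list list \<Rightarrow> bool pmf"

definition std_output ::
    "std_machine \<Rightarrow> nat \<Rightarrow> real \<Rightarrow> nat \<Rightarrow> bool list pmf \<Rightarrow> bool pmf" where
  "std_output T n \<epsilon> S P = bind_pmf (replicate_pmf S P) (T n \<epsilon>)"

definition std_tester ::
    "(nat \<Rightarrow> bool list pmf set) \<Rightarrow> (nat \<Rightarrow> real \<Rightarrow> nat) \<Rightarrow> std_machine \<Rightarrow> bool" where
  "std_tester D s T \<longleftrightarrow>
     (\<forall>n\<ge>1. \<forall>\<epsilon>\<in>{0<..1}. \<forall>P\<in>distributions n.
        (P \<in> D n \<longrightarrow> pmf (std_output T n \<epsilon> (s n \<epsilon>) P) True \<ge> 2/3) \<and>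
        (far_from (tv_dist n) \<epsilon> P (D n) \<longrightarrow> pmf (std_output T n \<epsilon> (s n \<epsilon>) P) False \<ge> 2/3))"

definition std_one_sided ::
    "(nat \<Rightarrow> bool list pmf set) \<Rightarrow> (nat \<Rightarrow> real \<Rightarrow> nat) \<Rightarrow> std_machine \<Rightarrow> bool" where
  "std_one_sided D s T \<longleftrightarrow>
     (\<forall>n\<ge>1. \<forall>\<epsilon>\<in>{0<..1}. \<forall>P\<in>D n. pmf (std_output T n \<epsilon> (s n \<epsilon>) P) True = 1)"


section \<open>The DoHO model\<close>

text \<open>A deterministic adaptive query algorithm: \<open>Query i j t0 t1\<close> queries bit \<open>j\<close> of sample \<open>i\<close>
  and continues with \<open>t1\<close> if that bit is \<open>True\<close> and with \<open>t0\<close> otherwise. A probabilistic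
  machine is a distribution over such algorithms, i.e. over the outcomes of its coin tosses.\<close>

datatype query_alg = Verdict bool | Query nat nat query_alg query_alg

fun run :: "query_alg \<Rightarrow> bool list list \<Rightarrow> bool" where
  "run (Verdict b) xs = b"
| "run (Query i j t0 t1) xs = run (if xs ! i ! j then t1 else t0) xs"

fun queries :: "query_alg \<Rightarrow> bool list list \<Rightarrow> (nat \<times> nat) list" where
  "queries (Verdict b) xs = []"
| "queries (Query i j t0 t1) xs = (i, j) # queries (if xs ! i ! j then t1 else t0) xs"

type_synonym doho_machine = "nat \<Rightarrow> real \<Rightarrow> query_alg pmf"

definition doho_output ::
    "doho_machine \<Rightarrow> nat \<Rightarrow> real \<Rightarrow> nat \<Rightarrow> bool list pmf \<Rightarrow> bool pmf" where
  "doho_output A n \<epsilon> S P =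
     bind_pmf (A n \<epsilon>) (\<lambda>t. map_pmf (run t) (replicate_pmf S P))"

definition sample_lists :: "nat \<Rightarrow> nat \<Rightarrow> bool list list set" where
  "sample_lists n S = {xs. length xs = S \<and> set xs \<subseteq> cube n}"

text \<open>\<open>doho_tester D s q A\<close>: \<open>A\<close> is a tester for \<open>D\<close> of sample complexity \<open>s\<close> whose query
  complexity (the maximal number of queries over all coin tosses and samples) is at most
  \<open>q\<close>.\<close>

definition doho_tester ::
    "(nat \<Rightarrow> bool list pmf set) \<Rightarrow> (nat \<Rightarrow> real \<Rightarrow> nat) \<Rightarrow> (nat \<Rightarrow> real \<Rightarrow> nat) \<Rightarrow>
     doho_machine \<Rightarrow> bool" where
  "doho_tester D s q A \<longleftrightarrow>
     (\<forall>n\<ge>1. \<forall>\<epsilon>\<in>{0<..1}.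
        (\<forall>t\<in>set_pmf (A n \<epsilon>). \<forall>xs\<in>sample_lists n (s n \<epsilon>).
           set (queries t xs) \<subseteq> {..<s n \<epsilon>} \<times> {..<n} \<and> length (queries t xs) \<le> q n \<epsilon>) \<and>
        (\<forall>P\<in>distributions n.
           (P \<in> D n \<longrightarrow> pmf (doho_output A n \<epsilon> (s n \<epsilon>) P) True \<ge> 2/3) \<and>
           (far_from (emd n) \<epsilon> P (D n) \<longrightarrow> pmf (doho_output A n \<epsilon> (s n \<epsilon>) P) False \<ge> 2/3)))"

definition doho_one_sided ::
    "(nat \<Rightarrow> bool list pmf set) \<Rightarrow> (nat \<Rightarrow> real \<Rightarrow> nat) \<Rightarrow> doho_machine \<Rightarrow> bool" where
  "doho_one_sided D s A \<longleftrightarrow>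
     (\<forall>n\<ge>1. \<forall>\<epsilon>\<in>{0<..1}. \<forall>P\<in>D n. pmf (doho_output A n \<epsilon> (s n \<epsilon>) P) True = 1)"

text \<open>The machine draws \<open>m\<close> positions \<open>js\<close> independently and uniformly, and then, whatever its
  remaining coin tosses \<open>K js\<close> and the answers are, it queries exactly the positions \<open>js\<close>
  (with multiplicity, in some order) in each of the \<open>S\<close> samples.\<close>

definition same_uniform_queries :: "nat \<Rightarrow> nat \<Rightarrow> nat \<Rightarrow> query_alg pmf \<Rightarrow> bool" where
  "same_uniform_queries n S m A \<longleftrightarrow>
     (\<exists>K. A = bind_pmf (replicate_pmf m (pmf_of_set {..<n})) K \<and>
        (\<forall>js\<in>set_pmf (replicate_pmf m (pmf_of_set {..<n})). \<forall>t\<in>set_pmf (K js).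
           \<forall>xs\<in>sample_lists n S. mset (queries t xs) = mset (List.product [0..<S] js)))"

end

(* Mask every sample to a random set of positions, relabel the masked strings by a random
   permutation of the cube, and take the majority of three runs of the given tester. Masking and
   relabelling are mappings, so a distribution with the property keeps it.

   Conversely, let P be eps-far. For most choices of the positions, strings that are more than
   eps/4 apart rarely agree on them. Hence every fibre of the mask of non-negligible mass is
   concentrated near one of its points, and collapsing these fibres moves P by at most eps/2. The
   resulting distribution P' is rejected, since earth mover's distance is at most total variation
   distance. Samples of P' and masked samples of P have the same pattern of equalities unless two
   of them meet in a light fibre, and the random relabelling makes the verdict depend on this
   pattern only. *)

theory Submission
  imports Defs "HOL-Combinatorics.Permutations"
begin

section \<open>Random samples\<close>

text \<open>The masked distribution cannot be compared with P directly, since resetting the unread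
  bits may move it far away. The comparison goes through a map \<open>h\<close> of the cube that
  stays inside the fibres of the mask: moving x to \<open>h x\<close> is cheap on average, while the
  mask cannot tell the two apart.

  The number s of samples fixes the border between light and heavy fibres: for \<tau> = 1/(270 s^2),
  3s samples rarely meet in a fibre of mass below \<tau>. Collapsing the heavy fibres moves farther
  than \<epsilon>/4 at most 1/\<tau> times the probability that two independent samples agree on the
  positions although they are more than \<epsilon>/4 apart. This probability must therefore be
  O(\<epsilon>/s^2). Its expectation over m random positions is at most (1 - \<epsilon>/4)^m, so m =
  O(log(s/\<epsilon>)/\<epsilon>) positions suffice.

  The majority vote is there because a success probability of 2/3 leaves no room for the two error
  events, bad positions and meetings in light fibres.\<close>

lemma finite_cube [simp]: "finite (cube n)"
  using finite_lists_length_eq[of "UNIV :: bool set" n] by (simp add: cube_def)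

text \<open>Values in [0, 1] make the loss on the exceptional event \<open>B\<close> at most its
  probability. Both error events of the soundness proof are paid for in this way.\<close>

lemma integral_le_except:
  fixes u v :: "'a \<Rightarrow> real"
  assumes u: "\<And>x. 0 \<le> u x" "\<And>x. u x \<le> 1" and v: "\<And>x. 0 \<le> v x" "\<And>x. v x \<le> 1"
    and le: "\<And>x. x \<in> set_pmf p \<Longrightarrow> x \<notin> B \<Longrightarrow> u x \<le> v x"
  shows "measure_pmf.expectation p u \<le> measure_pmf.expectation p v + measure_pmf.prob p B"
proof -
  have int: "integrable (measure_pmf p) u" "integrable (measure_pmf p) v"
    using u v by (auto intro!: measure_pmf.integrable_const_bound[where B = 1])
  have "measure_pmf.expectation p u \<le> measure_pmf.expectation p (\<lambda>x. v x + indicator B x)"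
  proof (rule integral_mono_AE)
    show "AE x in measure_pmf p. u x \<le> v x + indicator B x"
      using le u v by (auto simp: AE_measure_pmf_iff indicator_def add_increasing)
  qed (auto intro!: int integrable_real_indicator simp: measure_pmf.emeasure_eq_measure)
  also have "\<dots> = measure_pmf.expectation p v + measure_pmf.prob p B"
    by (subst Bochner_Integration.integral_add)
       (auto intro!: int integrable_real_indicator simp: measure_pmf.emeasure_eq_measure)
  finally show ?thesis .
qed

lemma pmf_bind_le_except:
  assumes "\<And>x. x \<in> set_pmf p \<Longrightarrow> x \<notin> B \<Longrightarrow> pmf (F x) b \<le> pmf (G x) b"
  shows "pmf (bind_pmf p F) b \<le> pmf (bind_pmf p G) b + measure_pmf.prob p B"
  unfolding pmf_bind using assms by (intro integral_le_except) (auto simp: pmf_le_1)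

lemma pmf_bind_ge_except:
  assumes "\<And>x. x \<in> set_pmf p \<Longrightarrow> x \<notin> B \<Longrightarrow> c \<le> pmf (F x) b" and "0 \<le> c" "c \<le> 1"
  shows "c \<le> pmf (bind_pmf p F) b + measure_pmf.prob p B"
  using integral_le_except[of "\<lambda>_. c" "\<lambda>x. pmf (F x) b" p B] assms
  by (simp add: pmf_bind pmf_le_1)

lemma pmf_bind_ge:
  assumes "\<And>x. x \<in> set_pmf p \<Longrightarrow> c \<le> pmf (F x) b" and "0 \<le> c" "c \<le> 1"
  shows "c \<le> pmf (bind_pmf p F) b"
  using pmf_bind_ge_except[of p "{}" c F b] assms by simp

lemma measure_bind_pmf_eq:
  fixes A :: "'b set"
  shows
  "measure_pmf.prob (bind_pmf p f) A = measure_pmf.expectation p (\<lambda>x. measure_pmf.prob (f x) A)"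
proof -
  have prob: "measure_pmf.prob q A = pmf (map_pmf (\<lambda>x. x \<in> A) q) True" for q :: "'b pmf"
    by (simp add: pmf_map vimage_def)
  show ?thesis
    by (simp add: prob map_bind_pmf pmf_bind)
qed

lemma prob_replicate_Suc:
  "measure_pmf.prob (replicate_pmf (Suc N) p) A =
   measure_pmf.expectation p (\<lambda>x. measure_pmf.prob (replicate_pmf N p) {xs. x # xs \<in> A})"
  by (simp add: measure_bind_pmf_eq map_pmf_def[symmetric] vimage_def)

text \<open>A union bound over pairs of samples. Irreflexivity excludes a clash of an entry with
  itself, and symmetry leaves only the clashes of the first sample with the later ones to be added
  in each induction step; \<open>N ^ 2\<close> generously covers the number of pairs.\<close>

lemma prob_replicate_clash:
  assumes "\<And>x. x \<in> set_pmf P \<Longrightarrow> measure_pmf.prob P {y. R x y} \<le> \<tau>"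
    and refl: "\<And>x. \<not> R x x" and sym: "\<And>x y. R x y \<Longrightarrow> R y x" and "\<tau> \<ge> 0"
  shows "measure_pmf.prob (replicate_pmf N P) {xs. \<exists>x\<in>set xs. \<exists>y\<in>set xs. R x y} \<le> real N ^ 2 * \<tau>"
proof -
  let ?pr = "\<lambda>N. measure_pmf.prob (replicate_pmf N P)"
  \<comment> \<open>Conditioning on the first sample: it may be bad by itself (\<open>C\<close>) or
    make the rest bad (\<open>B x\<close>). The inner induction uses \<open>C\<close>, the outer one
    the dependence of \<open>B\<close> on \<open>x\<close>.\<close>
  have split: "measure_pmf.prob (replicate_pmf (Suc N) P) A \<le> a + b"
    if "\<And>x. x \<in> set_pmf P \<Longrightarrow> ?pr N (B x) \<le> a" "measure_pmf.prob P C \<le> b" "a \<ge> 0"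
      "\<And>x xs. x # xs \<in> A \<Longrightarrow> x \<in> C \<or> xs \<in> B x" for N A B C a b
  proof -
    have "?pr (Suc N) A = measure_pmf.expectation P (\<lambda>x. ?pr N {xs. x # xs \<in> A})"
      by (rule prob_replicate_Suc)
    also have "\<dots> \<le> measure_pmf.expectation P (\<lambda>x. ?pr N (B x)) + measure_pmf.prob P C"
      using that by (intro integral_le_except measure_pmf.finite_measure_mono) auto
    also have "measure_pmf.expectation P (\<lambda>x. ?pr N (B x)) \<le> a"
    proof (rule measure_pmf.integral_le_const)
      show "integrable (measure_pmf P) (\<lambda>x. ?pr N (B x))"
        by (rule measure_pmf.integrable_const_bound[where B = 1]) auto
    qed (use that in \<open>auto simp: AE_measure_pmf_iff\<close>)
    finally show ?thesis using that by simp
  qed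
  have one: "?pr N {xs. \<exists>y\<in>set xs. R x y} \<le> real N * \<tau>" if "x \<in> set_pmf P" for x N
  proof (induction N)
    case (Suc N)
    show ?case
      using split[where a = "real N * \<tau>" and b = \<tau> and B = "\<lambda>_. {xs. \<exists>y\<in>set xs. R x y}"
          and C = "{y. R x y}" and N = N and A = "{xs. \<exists>y\<in>set xs. R x y}"] Suc assms that
      by (auto simp: algebra_simps)
  qed simp
  show ?thesis
  proof (induction N)
    case (Suc N)
    let ?A = "{xs. \<exists>x\<in>set xs. \<exists>y\<in>set xs. R x y}"
    have "?pr (Suc N) ?A \<le> (real N ^ 2 * \<tau> + real N * \<tau>) + 0"
    proof (rule split[where B = "\<lambda>x. ?A \<union> {xs. \<exists>y\<in>set xs. R x y}" and C = "{}"])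
      fix x assume "x \<in> set_pmf P"
      then show "?pr N (?A \<union> {xs. \<exists>y\<in>set xs. R x y}) \<le> real N ^ 2 * \<tau> + real N * \<tau>"
        using Suc one[of x N] by (intro order_trans[OF measure_Un_le]) auto
    qed (use assms refl sym in \<open>auto, blast\<close>)
    also have "\<dots> \<le> real (Suc N) ^ 2 * \<tau>"
      using \<open>\<tau> \<ge> 0\<close> by (simp add: power2_eq_square algebra_simps)
    finally show ?case .
  qed simp
qed

lemma prob_replicate_subset:
  "measure_pmf.prob (replicate_pmf m p) {xs. set xs \<subseteq> G} = measure_pmf.prob p G ^ m"
proof (induction m)
  case (Suc m)
  have "measure_pmf.prob (replicate_pmf (Suc m) p) {xs. set xs \<subseteq> G}
      = measure_pmf.expectation p (\<lambda>x. measure_pmf.prob (replicate_pmf m p) {xs. set (x # xs) \<subseteq> G})"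
    by (simp only: prob_replicate_Suc mem_Collect_eq)
  also have "\<dots> = measure_pmf.expectation p (\<lambda>x. indicator G x * measure_pmf.prob p G ^ m)"
    by (intro Bochner_Integration.integral_cong) (auto simp: Suc[symmetric] indicator_def vimage_def)
  finally show ?case by simp
qed simp

section \<open>Bounding the earth mover's distance\<close>

lemma rel_hamming_nonneg: "0 \<le> rel_hamming n x y"
  by (simp add: rel_hamming_def)

lemma rel_hamming_self [simp]: "rel_hamming n x x = 0"
  by (simp add: rel_hamming_def)

lemma card_disagree_le: "card {i. i < n \<and> Q i} \<le> n"
  using card_mono[of "{..<n}" "{i. i < n \<and> Q i}"] by auto

lemma rel_hamming_le_1: "rel_hamming n x y \<le> 1"
  using card_disagree_le[of n] by (auto simp: rel_hamming_def divide_le_eq_1)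

lemma rel_hamming_triangle: "rel_hamming n x z \<le> rel_hamming n x y + rel_hamming n y z"
proof -
  have "card {i. i < n \<and> x ! i \<noteq> z ! i}
      \<le> card ({i. i < n \<and> x ! i \<noteq> y ! i} \<union> {i. i < n \<and> y ! i \<noteq> z ! i})"
    by (intro card_mono) auto
  also have "\<dots> \<le> card {i. i < n \<and> x ! i \<noteq> y ! i} + card {i. i < n \<and> y ! i \<noteq> z ! i}"
    by (rule card_Un_le)
  finally show ?thesis
    by (simp add: rel_hamming_def add_divide_distrib[symmetric] divide_right_mono)
qed

lemma sum_pmf_cube: "P \<in> distributions n \<Longrightarrow> (\<Sum>x\<in>cube n. pmf P x) = 1"
  by (simp add: distributions_def sum_pmf_eq_1)

lemma pmf_map_cube:
  assumes "P \<in> distributions n"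
  shows "pmf (map_pmf h P) y = (\<Sum>x\<in>cube n. if h x = y then pmf P x else 0)"
proof -
  have "pmf (map_pmf h P) y = measure_pmf.prob P (h -` {y} \<inter> set_pmf P)"
    by (simp add: pmf_map measure_Int_set_pmf)
  also have "\<dots> = measure_pmf.prob P ({x \<in> cube n. h x = y} \<inter> set_pmf P)"
    using assms by (intro arg_cong[where f = "measure_pmf.prob P"]) (auto simp: distributions_def)
  also have "\<dots> = (\<Sum>x\<in>{x \<in> cube n. h x = y}. pmf P x)"
    by (subst measure_Int_set_pmf) (simp add: measure_measure_pmf_finite)
  finally show ?thesis
    by (simp add: sum.inter_filter[symmetric])
qed

lemma map_distributions:
  assumes "P \<in> distributions n" "h \<in> cube n \<rightarrow> cube n"
  shows "map_pmf h P \<in> distributions n"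
  using assms by (auto simp: distributions_def Pi_iff)

lemma sum_pmf_map_cube:
  assumes P: "P \<in> distributions n" and h: "h \<in> cube n \<rightarrow> cube n"
  shows "(\<Sum>y\<in>cube n. pmf (map_pmf h P) y * F y) = (\<Sum>x\<in>cube n. pmf P x * F (h x))"
proof -
  have "(\<Sum>y\<in>cube n. pmf (map_pmf h P) y * F y)
      = (\<Sum>y\<in>cube n. \<Sum>x\<in>cube n. if h x = y then pmf P x * F y else 0)"
    by (auto simp: pmf_map_cube[OF P] sum_distrib_right intro!: sum.cong)
  also have "\<dots> = (\<Sum>x\<in>cube n. \<Sum>y\<in>cube n. if h x = y then pmf P x * F y else 0)"
    by (rule sum.swap)
  also have "\<dots> = (\<Sum>x\<in>cube n. pmf P x * F (h x))"
    using h by (intro sum.cong refl) (auto simp: Pi_iff)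
  finally show ?thesis .
qed

lemma emd_le_cost:
  assumes "w \<in> transport_plans n P Q"
  shows "emd n P Q \<le> (\<Sum>x\<in>cube n. \<Sum>y\<in>cube n. w x y * rel_hamming n x y)"
  unfolding emd_def
proof (rule cINF_lower[OF _ assms])
  show "bdd_below ((\<lambda>w. \<Sum>x\<in>cube n. \<Sum>y\<in>cube n. w x y * rel_hamming n x y) ` transport_plans n P Q)"
    by (rule bdd_belowI[of _ 0])
       (auto simp: transport_plans_def intro!: sum_nonneg mult_nonneg_nonneg rel_hamming_nonneg)
qed

text \<open>The mass at \<open>x\<close> first moves to \<open>h x\<close>, then the image distribution \<open>map_pmf h P\<close> is
  turned into \<open>Q\<close> by moving only its excess over \<open>Q\<close>, proportionally to the excess of \<open>Q\<close>.
  If both excesses vanish, then \<open>t = 0\<close> and the division by \<open>t\<close> yields the harmless value \<open>0\<close>.\<close>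

lemma emd_le_map_tv:
  assumes P: "P \<in> distributions n" and Q: "Q \<in> distributions n" and h: "h \<in> cube n \<rightarrow> cube n"
  shows "emd n P Q \<le> (\<Sum>x\<in>cube n. pmf P x * rel_hamming n x (h x)) + tv_dist n (map_pmf h P) Q"
proof -
  define P' where "P' = map_pmf h P"
  define m where "m y = min (pmf P' y) (pmf Q y)" for y
  define t where "t = tv_dist n P' Q"
  define k where "k z y = (if y = z then m z / pmf P' z else 0)
      + (1 - m z / pmf P' z) * ((pmf Q y - m y) / t)" for z y
  define w where "w x y = pmf P x * k (h x) y" for x y
  have P': "P' \<in> distributions n"
    unfolding P'_def by (rule map_distributions[OF P h])
  have m: "0 \<le> m y" "m y \<le> pmf P' y" "m y \<le> pmf Q y" for y
    by (auto simp: m_def)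
  have eq: "\<bar>pmf P' y - pmf Q y\<bar> = (pmf P' y - m y) + (pmf Q y - m y)" for y
    by (auto simp: m_def)
  have diff: "(\<Sum>y\<in>cube n. pmf P' y - m y) = (\<Sum>y\<in>cube n. pmf Q y - m y)"
    by (simp add: sum_subtractf sum_pmf_cube[OF P'] sum_pmf_cube[OF Q])
  have t2: "(\<Sum>y\<in>cube n. pmf Q y - m y) = t"
    unfolding t_def tv_dist_def eq sum.distrib diff by simp
  have t1: "(\<Sum>y\<in>cube n. pmf P' y - m y) = t"
    using diff t2 by simp
  have t0: "0 \<le> t"
    by (simp add: t_def tv_dist_def sum_nonneg)
  have ratio: "0 \<le> m z / pmf P' z" "m z / pmf P' z \<le> 1" for z
    using m[of z] by (auto simp: divide_le_eq_1)
  have excess: "pmf P' z * (1 - m z / pmf P' z) = pmf P' z - m z" for z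
    using m[of z] by (cases "pmf P' z = 0") (auto simp: algebra_simps)
  have zero: "pmf P' y - m y = 0" "pmf Q y - m y = 0" if "t = 0" "y \<in> cube n" for y
    using t1 t2 that m by (simp_all add: sum_nonneg_eq_0_iff del: sum_subtractf)
  have k0: "0 \<le> k z y" for z y
    using ratio[of z] m[of y] t0 by (auto simp: k_def)
  \<comment> \<open>The factor \<open>pmf P' z\<close> matters: for \<open>t = 0\<close> a row with
    \<open>pmf P' z = 0\<close> sums to \<open>0\<close> instead of \<open>1\<close>.\<close>
  have row: "pmf P' z * (\<Sum>y\<in>cube n. k z y) = pmf P' z" if "z \<in> cube n" for z
  proof -
    have "(\<Sum>y\<in>cube n. k z y) = m z / pmf P' z + (1 - m z / pmf P' z) * (t / t)"
      using that by (simp add: k_def sum.distrib sum_distrib_left[symmetric] sum_divide_distrib[symmetric]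
          t2 del: sum_subtractf)
    then show ?thesis
      using zero(1)[of z] that excess[of z] by (cases "t = 0"; cases "pmf P' z = 0") auto
  qed
  have "w \<in> transport_plans n P Q"
    unfolding transport_plans_def
  proof (intro CollectI conjI ballI)
    fix x y
    show "0 \<le> w x y"
      by (simp add: w_def k0)
  next
    fix x assume x: "x \<in> cube n"
    have hx: "h x \<in> cube n" using h x by auto
    show "(\<Sum>y\<in>cube n. w x y) = pmf P x"
    proof (cases "x \<in> set_pmf P")
      case True
      then have "h x \<in> set_pmf P'" by (simp add: P'_def)
      then show ?thesis
        using row[OF hx] by (simp add: w_def sum_distrib_left[symmetric] set_pmf_iff)
    qed (simp add: w_def set_pmf_iff)
  next
    fix y assume y: "y \<in> cube n"
    have "(\<Sum>x\<in>cube n. w x y) = (\<Sum>z\<in>cube n. pmf P' z * k z y)"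
      unfolding w_def P'_def by (rule sum_pmf_map_cube[OF P h, symmetric])
    also have "\<dots> = (\<Sum>z\<in>cube n. (if y = z then m z else 0) + (pmf P' z - m z) * ((pmf Q y - m y) / t))"
    proof (rule sum.cong[OF refl])
      fix z
      have "pmf P' z * k z y = (if y = z then pmf P' z * (m z / pmf P' z) else 0)
          + pmf P' z * (1 - m z / pmf P' z) * ((pmf Q y - m y) / t)"
        unfolding k_def distrib_left mult.assoc by (cases "y = z") simp_all
      then show "pmf P' z * k z y = (if y = z then m z else 0) + (pmf P' z - m z) * ((pmf Q y - m y) / t)"
        unfolding excess using m[of z] by auto
    qed
    also have "\<dots> = m y + t * ((pmf Q y - m y) / t)"
      unfolding sum.distrib sum_distrib_right[symmetric] t1 using y by simp
    also have "\<dots> = pmf Q y"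
      using zero(2)[OF _ y] by (cases "t = 0") auto
    finally show "(\<Sum>x\<in>cube n. w x y) = pmf Q y" .
  qed
  then have "emd n P Q \<le> (\<Sum>x\<in>cube n. \<Sum>y\<in>cube n. w x y * rel_hamming n x y)"
    by (rule emd_le_cost)
  also have "\<dots> \<le> (\<Sum>x\<in>cube n. \<Sum>y\<in>cube n. w x y * rel_hamming n x (h x))
      + (\<Sum>x\<in>cube n. \<Sum>y\<in>cube n. w x y * rel_hamming n (h x) y)"
    unfolding sum.distrib[symmetric] distrib_left[symmetric]
    by (intro sum_mono mult_left_mono rel_hamming_triangle) (simp add: w_def k0)
  also have "(\<Sum>x\<in>cube n. \<Sum>y\<in>cube n. w x y * rel_hamming n x (h x))
      = (\<Sum>x\<in>cube n. pmf P x * rel_hamming n x (h x))"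
    using \<open>w \<in> _\<close> by (simp add: transport_plans_def sum_distrib_right[symmetric])
  also have "(\<Sum>x\<in>cube n. \<Sum>y\<in>cube n. w x y * rel_hamming n (h x) y)
      = (\<Sum>z\<in>cube n. pmf P' z * (\<Sum>y\<in>cube n. k z y * rel_hamming n z y))"
    unfolding P'_def sum_pmf_map_cube[OF P h] by (simp add: w_def sum_distrib_left mult.assoc)
  \<comment> \<open>Only the excess pays: mass that stays at \<open>z\<close> has distance
    \<open>0\<close>, and all other distances are at most \<open>1\<close>.\<close>
  also have "\<dots> \<le> (\<Sum>z\<in>cube n. pmf P' z - m z)"
  proof (rule sum_mono)
    fix z assume z: "z \<in> cube n"
    have "(\<Sum>y\<in>cube n. k z y * rel_hamming n z y)
        \<le> (\<Sum>y\<in>cube n. (1 - m z / pmf P' z) * ((pmf Q y - m y) / t))"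
    proof (rule sum_mono)
      fix y
      have "0 \<le> (1 - m z / pmf P' z) * ((pmf Q y - m y) / t)"
        using ratio[of z] m[of y] t0 by simp
      then show "k z y * rel_hamming n z y \<le> (1 - m z / pmf P' z) * ((pmf Q y - m y) / t)"
        using mult_right_le_one_le[OF _ rel_hamming_nonneg[of n z y] rel_hamming_le_1[of n z y]]
        by (cases "y = z") (simp_all only: k_def rel_hamming_self mult_zero_right if_False add_0)
    qed
    also have "\<dots> = (1 - m z / pmf P' z) * (t / t)"
      by (simp add: sum_distrib_left[symmetric] sum_divide_distrib[symmetric] t2 del: sum_subtractf)
    also have "\<dots> \<le> 1 - m z / pmf P' z"
      using ratio[of z] by (cases "t = 0") auto
    finally have "pmf P' z * (\<Sum>y\<in>cube n. k z y * rel_hamming n z y)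
        \<le> pmf P' z * (1 - m z / pmf P' z)"
      by (rule mult_left_mono) simp
    then show "pmf P' z * (\<Sum>y\<in>cube n. k z y * rel_hamming n z y) \<le> pmf P' z - m z"
      unfolding excess .
  qed
  finally show ?thesis
    using t1 by (simp add: t_def P'_def)
qed

lemma emd_le_tv:
  "P \<in> distributions n \<Longrightarrow> Q \<in> distributions n \<Longrightarrow> emd n P Q \<le> tv_dist n P Q"
  using emd_le_map_tv[of P n Q id] by (simp add: map_pmf_id[unfolded id_def] id_def)

lemma emd_return_pmf_le:
  assumes "P \<in> distributions n" "y \<in> cube n"
  shows "emd n P (return_pmf y) \<le> (\<Sum>x\<in>cube n. pmf P x * rel_hamming n x y)"
  using emd_le_map_tv[of P n "return_pmf y" "\<lambda>_. y"] assms
  by (simp add: distributions_def map_pmf_const tv_dist_def)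

text \<open>The distances of any string to the all-ones and to the all-zeros string add up to \<open>1\<close>.\<close>

lemma emd_constant_string_le_half:
  assumes P: "P \<in> distributions n" and n: "n \<ge> 1"
  obtains b where "emd n P (return_pmf (replicate n b)) \<le> 1 / 2"
proof -
  have 1: "rel_hamming n x (replicate n True) + rel_hamming n x (replicate n False) = 1" for x
  proof -
    have "card {i. i < n \<and> x ! i \<noteq> replicate n True ! i} + card {i. i < n \<and> x ! i \<noteq> replicate n False ! i}
        = card ({i. i < n \<and> \<not> x ! i} \<union> {i. i < n \<and> x ! i})"
      by (subst card_Un_disjoint) (auto intro!: arg_cong2[where f = "(+)"] arg_cong[where f = card])
    also have "{i. i < n \<and> \<not> x ! i} \<union> {i. i < n \<and> x ! i} = {..<n}" by auto
    finally show ?thesis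
      using n by (simp add: rel_hamming_def add_divide_distrib[symmetric] flip: of_nat_add)
  qed
  have "(\<Sum>x\<in>cube n. pmf P x * rel_hamming n x (replicate n True))
      + (\<Sum>x\<in>cube n. pmf P x * rel_hamming n x (replicate n False)) = 1"
    by (simp add: sum.distrib[symmetric] distrib_left[symmetric] 1 sum_pmf_cube[OF P])
  moreover have le: "emd n P (return_pmf (replicate n b))
      \<le> (\<Sum>x\<in>cube n. pmf P x * rel_hamming n x (replicate n b))" for b
    by (rule emd_return_pmf_le[OF P]) (simp add: cube_def)
  ultimately have "emd n P (return_pmf (replicate n True)) \<le> 1 / 2
      \<or> emd n P (return_pmf (replicate n False)) \<le> 1 / 2"
    using le[of True] le[of False] by linarith
  then show thesis using that by blast
qed

section \<open>Masks and their fibres\<close>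

text \<open>Every colour class that carries mass at least \<open>\<tau>\<close> is collapsed to one of its points,
  chosen to be related to few points of its class; averaging over the class shows that such a
  point exists.\<close>

lemma ex_representatives:
  fixes p :: "'a \<Rightarrow> real" and f :: "'a \<Rightarrow> 'b"
  assumes fin: "finite X" and p: "\<And>x. 0 \<le> p x" and irrefl: "\<And>x. \<not> R x x" and \<tau>: "0 < \<tau>"
  defines "collisions \<equiv> (\<Sum>x\<in>X. \<Sum>y\<in>X. if f x = f y \<and> R x y then p x * p y else 0)"
  shows "\<exists>h\<in>X \<rightarrow> X. (\<forall>x\<in>X. f (h x) = f x) \<and>
    (\<forall>x y. \<tau> \<le> (\<Sum>x'\<in>{x'\<in>X. f x' = f x}. p x') \<longrightarrow> f x = f y \<longrightarrow> h x = h y) \<and>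
    (\<Sum>x\<in>X. if R x (h x) then p x else 0) \<le> collisions / \<tau>"
proof -
  define cl where "cl z = {x\<in>X. f x = z}" for z
  define mass where "mass z = (\<Sum>x\<in>cl z. p x)" for z
  define F where "F z y = (\<Sum>x\<in>cl z. if R x y then p x else 0)" for z y
  define B where "B z = (\<Sum>y\<in>cl z. p y * F z y)" for z
  have B0: "0 \<le> B z" for z
    by (auto simp: B_def F_def intro!: sum_nonneg mult_nonneg_nonneg p)
  have finc: "finite (cl z)" for z
    using fin by (simp add: cl_def)
  have coll: "collisions = (\<Sum>z\<in>f ` X. B z)"
  proof -
    have "(\<Sum>y\<in>X. p y * F (f y) y) = (\<Sum>z\<in>f ` X. \<Sum>y\<in>{y\<in>X. f y = z}. p y * F (f y) y)"
      using fin by (rule sum.image_gen)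
    also have "\<dots> = (\<Sum>z\<in>f ` X. B z)"
      by (intro sum.cong refl) (auto simp: B_def cl_def)
    finally have "(\<Sum>z\<in>f ` X. B z) = (\<Sum>y\<in>X. p y * F (f y) y)" ..
    also have "\<dots> = (\<Sum>y\<in>X. \<Sum>x\<in>X. if f x = f y \<and> R x y then p x * p y else 0)"
      using fin by (intro sum.cong refl)
        (auto simp: F_def cl_def sum_distrib_left sum.inter_filter intro!: sum.cong)
    also have "\<dots> = collisions"
      unfolding collisions_def by (rule sum.swap)
    finally show ?thesis ..
  qed
  have ex: "\<exists>y\<in>cl z. F z y \<le> B z / \<tau>" if "\<tau> \<le> mass z" for z
  proof (rule ccontr)
    assume "\<not> ?thesis"
    then have less: "B z / \<tau> < F z y" if "y \<in> cl z" for y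
      using that by force
    have nonneg: "0 \<le> p y * (F z y - B z / \<tau>)" if "y \<in> cl z" for y
      using less[OF that] p[of y] by simp
    \<comment> \<open>A sum of nonnegative terms turns out to be at most \<open>0\<close>. Since the
      second factors are strictly positive, all weights \<open>p y\<close> on the class must vanish,
      contradicting its positive mass.\<close>
    have "(\<Sum>y\<in>cl z. p y * (F z y - B z / \<tau>)) = B z - mass z * (B z / \<tau>)"
      unfolding right_diff_distrib sum_subtractf mass_def sum_distrib_right by (simp add: B_def)
    also have "\<dots> \<le> 0"
    proof -
      have "B z = \<tau> * (B z / \<tau>)" using \<tau> by simp
      also have "\<dots> \<le> mass z * (B z / \<tau>)"
        using that B0[of z] \<tau> by (intro mult_right_mono) auto
      finally show ?thesis by simp
    qed
    finally have "(\<Sum>y\<in>cl z. p y * (F z y - B z / \<tau>)) = 0"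
      using nonneg by (intro antisym sum_nonneg)
    then have "\<forall>y\<in>cl z. p y * (F z y - B z / \<tau>) = 0"
      by (simp only: sum_nonneg_eq_0_iff[OF finc nonneg])
    then have "\<forall>y\<in>cl z. p y = 0"
      using less by fastforce
    then show False using that \<tau> by (simp add: mass_def)
  qed
  define g where "g z = (SOME y. y \<in> cl z \<and> F z y \<le> B z / \<tau>)" for z
  have g: "g z \<in> cl z" "F z (g z) \<le> B z / \<tau>" if "\<tau> \<le> mass z" for z
    using someI_ex[of "\<lambda>y. y \<in> cl z \<and> F z y \<le> B z / \<tau>"] ex[OF that] unfolding g_def by blast+
  \<comment> \<open>Light classes are fixed pointwise. This costs nothing because \<open>R\<close>
    is irreflexive, but their points stay apart.\<close>
  define h where "h x = (if \<tau> \<le> mass (f x) then g (f x) else x)" for x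
  have mem: "h x \<in> X \<and> f (h x) = f x" if "x \<in> X" for x
    using g(1)[of "f x"] that by (auto simp: h_def cl_def)
  have "(\<Sum>x\<in>X. if R x (h x) then p x else 0)
      = (\<Sum>z\<in>f ` X. \<Sum>x\<in>{x\<in>X. f x = z}. if R x (h x) then p x else 0)"
    using fin by (rule sum.image_gen)
  also have "\<dots> \<le> (\<Sum>z\<in>f ` X. B z / \<tau>)"
  proof (rule sum_mono)
    fix z
    show "(\<Sum>x\<in>{x\<in>X. f x = z}. if R x (h x) then p x else 0) \<le> B z / \<tau>"
    proof (cases "\<tau> \<le> mass z")
      case True
      have "(\<Sum>x\<in>{x\<in>X. f x = z}. if R x (h x) then p x else 0) = F z (g z)"
        unfolding F_def cl_def using True by (intro sum.cong) (auto simp: h_def)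
      then show ?thesis using g[OF True] by simp
    next
      case False
      then have "(\<Sum>x\<in>{x\<in>X. f x = z}. if R x (h x) then p x else 0) = 0"
        using irrefl by (intro sum.neutral) (auto simp: h_def)
      then show ?thesis using B0[of z] \<tau> by simp
    qed
  qed
  also have "\<dots> = collisions / \<tau>"
    by (simp add: coll sum_divide_distrib)
  finally show ?thesis
    using mem by (intro bexI[of _ h]) (auto simp: h_def mass_def cl_def)
qed

text \<open>Unread positions are reset to \<open>False\<close> rather than deleted, so that the mask
  maps the cube to itself and closure under mapping applies to it.\<close>

definition mask :: "nat list \<Rightarrow> bool list \<Rightarrow> bool list" where
  "mask js x = map (\<lambda>j. j \<in> set js \<and> x ! j) [0..<length x]"

lemma mask_cube: "mask js \<in> cube n \<rightarrow> cube n"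
  by (auto simp: mask_def cube_def)

lemma mask_eq_iff:
  assumes "x \<in> cube n" "y \<in> cube n" "set js \<subseteq> {..<n}"
  shows "mask js x = mask js y \<longleftrightarrow> (\<forall>j\<in>set js. x ! j = y ! j)"
  using assms by (auto simp: mask_def cube_def list_eq_iff_nth_eq)

text \<open>The masks agree iff all \<open>m\<close> independent positions fall into the set where
  the strings agree, whose density is \<open>1 - rel_hamming n x y\<close>.\<close>

lemma prob_mask_eq:
  assumes n: "n \<ge> 1" and xy: "x \<in> cube n" "y \<in> cube n"
  shows "measure_pmf.prob (replicate_pmf m (pmf_of_set {..<n})) {js. mask js x = mask js y}
    = (1 - rel_hamming n x y) ^ m"
proof -
  let ?J = "replicate_pmf m (pmf_of_set {..<n})"
  have ne: "{..<n} \<noteq> {}" using n by (simp add: lessThan_empty_iff)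
  have J: "set js \<subseteq> {..<n}" if "js \<in> set_pmf ?J" for js
    using that ne by (auto simp: set_replicate_pmf)
  have "measure_pmf.prob ?J {js. mask js x = mask js y}
      = measure_pmf.prob ?J {js. set js \<subseteq> {j. j < n \<and> x ! j = y ! j}}"
    using J mask_eq_iff[OF xy] by (intro measure_pmf.finite_measure_eq_AE) (auto simp: AE_measure_pmf_iff)
  also have "\<dots> = measure_pmf.prob (pmf_of_set {..<n}) {j. j < n \<and> x ! j = y ! j} ^ m"
    by (rule prob_replicate_subset)
  also have "measure_pmf.prob (pmf_of_set {..<n}) {j. j < n \<and> x ! j = y ! j} = 1 - rel_hamming n x y"
  proof -
    have "card {j. j < n \<and> x ! j = y ! j} + card {j. j < n \<and> x ! j \<noteq> y ! j}
        = card ({j. j < n \<and> x ! j = y ! j} \<union> {j. j < n \<and> x ! j \<noteq> y ! j})"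
      by (subst card_Un_disjoint) auto
    also have "{j. j < n \<and> x ! j = y ! j} \<union> {j. j < n \<and> x ! j \<noteq> y ! j} = {..<n}" by auto
    finally have "real (card {j. j < n \<and> x ! j = y ! j}) = real n - real (card {j. j < n \<and> x ! j \<noteq> y ! j})"
      by simp
    moreover have "{..<n} \<inter> {j. j < n \<and> x ! j = y ! j} = {j. j < n \<and> x ! j = y ! j}" by auto
    ultimately show ?thesis
      using n ne by (simp add: measure_pmf_of_set rel_hamming_def diff_divide_distrib)
  qed
  finally show ?thesis .
qed

text \<open>For P on the cube, the probability that two independent samples have the same mask and
  are more than \<alpha> apart. It instantiates the quantity \<open>collisions\<close> of
  \<open>ex_representatives\<close>.\<close>

definition far_collisions :: "nat \<Rightarrow> real \<Rightarrow> bool list pmf \<Rightarrow> nat list \<Rightarrow> real" where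
  "far_collisions n \<alpha> P js = (\<Sum>x\<in>cube n. \<Sum>y\<in>cube n.
     if mask js x = mask js y \<and> \<alpha> < rel_hamming n x y then pmf P x * pmf P y else 0)"

lemma far_collisions_nonneg: "0 \<le> far_collisions n \<alpha> P js"
  by (auto simp: far_collisions_def intro!: sum_nonneg)

text \<open>Linearity over pairs of strings: only the indicator of equal masks is random, and the
  weights \<open>pmf P x * pmf P y\<close> add up to \<open>1\<close>.\<close>

lemma expectation_far_collisions_le:
  assumes n: "n \<ge> 1" and P: "P \<in> distributions n" and \<alpha>: "0 \<le> \<alpha>" "\<alpha> \<le> 1"
  shows "measure_pmf.expectation (replicate_pmf m (pmf_of_set {..<n})) (far_collisions n \<alpha> P)
    \<le> (1 - \<alpha>) ^ m"
proof -
  let ?J = "replicate_pmf m (pmf_of_set {..<n})"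
  let ?c = "\<lambda>x y. if \<alpha> < rel_hamming n x y then pmf P x * pmf P y else 0"
  let ?I = "\<lambda>x y. indicator {js. mask js x = mask js y} :: nat list \<Rightarrow> real"
  have "far_collisions n \<alpha> P = (\<lambda>js. \<Sum>x\<in>cube n. \<Sum>y\<in>cube n. ?c x y * ?I x y js)"
    unfolding far_collisions_def by (intro ext sum.cong refl) auto
  moreover have "integrable (measure_pmf ?J) (\<lambda>js. c * indicator A js)" for c :: real and A
    by (rule measure_pmf.integrable_const_bound[where B = "\<bar>c\<bar>"]) (auto simp: indicator_def)
  ultimately have "measure_pmf.expectation ?J (far_collisions n \<alpha> P)
      = (\<Sum>x\<in>cube n. \<Sum>y\<in>cube n. measure_pmf.expectation ?J (\<lambda>js. ?c x y * ?I x y js))"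
    by (simp only: Bochner_Integration.integral_sum Bochner_Integration.integrable_sum)
  also have "\<dots> \<le> (\<Sum>x\<in>cube n. \<Sum>y\<in>cube n. pmf P x * pmf P y * (1 - \<alpha>) ^ m)"
  proof (intro sum_mono)
    fix x y assume xy: "x \<in> cube n" "y \<in> cube n"
    show "measure_pmf.expectation ?J (\<lambda>js. ?c x y * ?I x y js) \<le> pmf P x * pmf P y * (1 - \<alpha>) ^ m"
      using \<alpha> rel_hamming_le_1[of n x y]
      by (auto simp: prob_mask_eq[OF n xy] intro!: mult_left_mono power_mono)
  qed
  also have "\<dots> = (1 - \<alpha>) ^ m"
    by (simp add: sum_distrib_right[symmetric] sum_distrib_left[symmetric] sum_pmf_cube[OF P])
  finally show ?thesis .
qed

lemma prob_far_collisions_le: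
  assumes n: "n \<ge> 1" and P: "P \<in> distributions n" and \<alpha>: "0 \<le> \<alpha>" "\<alpha> \<le> 1" and \<theta>: "0 < \<theta>"
  shows "measure_pmf.prob (replicate_pmf m (pmf_of_set {..<n})) {js. \<theta> \<le> far_collisions n \<alpha> P js}
    \<le> (1 - \<alpha>) ^ m / \<theta>"
proof -
  let ?J = "replicate_pmf m (pmf_of_set {..<n})"
  have "far_collisions n \<alpha> P js \<le> (\<Sum>x\<in>cube n. \<Sum>y\<in>cube n. pmf P x * pmf P y)" for js
    unfolding far_collisions_def by (intro sum_mono) auto
  then have "integrable (measure_pmf ?J) (far_collisions n \<alpha> P)"
    using far_collisions_nonneg
    by (intro measure_pmf.integrable_const_bound[where B = "\<Sum>x\<in>cube n. \<Sum>y\<in>cube n. pmf P x * pmf P y"]) auto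
  then have "measure_pmf.prob ?J {js. \<theta> \<le> far_collisions n \<alpha> P js}
      \<le> measure_pmf.expectation ?J (far_collisions n \<alpha> P) / \<theta>"
    using integral_Markov_inequality_measure[where M = "measure_pmf ?J" and u = "far_collisions n \<alpha> P"
        and A = "{}" and c = \<theta>] far_collisions_nonneg \<theta> by simp
  also have "\<dots> \<le> (1 - \<alpha>) ^ m / \<theta>"
    using expectation_far_collisions_le[OF n P \<alpha>, of m] \<theta> by (simp add: divide_right_mono)
  finally show ?thesis .
qed

section \<open>Majority, relabelling and query algorithms\<close>

text \<open>The last line is the majority: if the first two verdicts differ, the third agrees with
  exactly one of them.\<close>

definition majority3 :: "nat \<Rightarrow> ('a list \<Rightarrow> bool pmf) \<Rightarrow> 'a list \<Rightarrow> bool pmf" where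
  "majority3 s T xs = do {
     a \<leftarrow> T (take s xs);
     b \<leftarrow> T (take s (drop s xs));
     c \<leftarrow> T (drop (2 * s) xs);
     return_pmf (if a = b then a else c)}"

text \<open>The three runs read disjoint blocks of samples, so they are independent. The draws are
  commuted until each block stands next to the run that uses it.\<close>

lemma bind_replicate_majority3:
  fixes s :: nat and P :: "'a pmf" and T :: "'a list \<Rightarrow> bool pmf"
  defines "q \<equiv> bind_pmf (replicate_pmf s P) T"
  shows "bind_pmf (replicate_pmf (3 * s) P) (majority3 s T)
    = do {a \<leftarrow> q; b \<leftarrow> q; c \<leftarrow> q; return_pmf (if a = b then a else c)}"
proof -
  let ?R = "replicate_pmf s P"
  have "bind_pmf (replicate_pmf (3 * s) P) (majority3 s T)
      = do {xs \<leftarrow> ?R; ys \<leftarrow> ?R; zs \<leftarrow> ?R; majority3 s T (xs @ ys @ zs)}"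
    using replicate_pmf_distrib[of s "s + s" P] replicate_pmf_distrib[of s s P]
    by (simp add: numeral_3_eq_3 bind_assoc_pmf bind_return_pmf)
  also have "\<dots> = do {xs \<leftarrow> ?R; ys \<leftarrow> ?R; zs \<leftarrow> ?R;
      a \<leftarrow> T xs; b \<leftarrow> T ys; c \<leftarrow> T zs; return_pmf (if a = b then a else c)}"
    by (intro bind_pmf_cong refl) (simp add: majority3_def set_replicate_pmf)
  also have "\<dots> = do {xs \<leftarrow> ?R; ys \<leftarrow> ?R; a \<leftarrow> T xs; zs \<leftarrow> ?R;
      b \<leftarrow> T ys; c \<leftarrow> T zs; return_pmf (if a = b then a else c)}"
    by (intro bind_pmf_cong refl bind_commute_pmf)
  also have "\<dots> = do {xs \<leftarrow> ?R; a \<leftarrow> T xs; ys \<leftarrow> ?R; zs \<leftarrow> ?R;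
      b \<leftarrow> T ys; c \<leftarrow> T zs; return_pmf (if a = b then a else c)}"
    by (intro bind_pmf_cong refl bind_commute_pmf)
  also have "\<dots> = do {xs \<leftarrow> ?R; a \<leftarrow> T xs; ys \<leftarrow> ?R; b \<leftarrow> T ys; zs \<leftarrow> ?R;
      c \<leftarrow> T zs; return_pmf (if a = b then a else c)}"
    by (intro bind_pmf_cong refl bind_commute_pmf)
  finally show ?thesis
    by (simp add: q_def bind_assoc_pmf)
qed

text \<open>The polynomial is \<open>r ^ 3 + 3 * r ^ 2 * (1 - r)\<close>, the probability of at
  least two successes in three runs. Its value \<open>1\<close> at \<open>r = 1\<close> is what
  preserves one-sided error.\<close>

lemma pmf_majority3:
  fixes s :: nat and P :: "'a pmf" and T :: "'a list \<Rightarrow> bool pmf" and v :: bool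
  defines "r \<equiv> pmf (bind_pmf (replicate_pmf s P) T) v"
  shows "pmf (bind_pmf (replicate_pmf (3 * s) P) (majority3 s T)) v = r\<^sup>2 * (3 - 2 * r)"
proof -
  define q where "q = bind_pmf (replicate_pmf s P) T"
  have bind: "pmf (bind_pmf q F) v = pmf q v * pmf (F v) v + (1 - pmf q v) * pmf (F (\<not> v)) v" for F
  proof -
    have "pmf q True + pmf q False = 1"
      using sum_pmf_eq_1[OF finite subset_UNIV, of q] by (simp add: UNIV_bool add.commute)
    then have "1 - pmf q v = pmf q (\<not> v)"
      by (cases v) simp_all
    then show ?thesis
      by (cases v) (simp_all add: pmf_bind integral_measure_pmf_real[of UNIV] UNIV_bool)
  qed
  show ?thesis
    unfolding bind_replicate_majority3 q_def[symmetric]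
    by (simp add: bind r_def q_def[symmetric]) (simp add: power2_eq_square algebra_simps)
qed

lemma pmf_majority3_ge:
  assumes "2 / 3 \<le> pmf (bind_pmf (replicate_pmf s P) T) v"
  shows "20 / 27 \<le> pmf (bind_pmf (replicate_pmf (3 * s) P) (majority3 s T)) v"
proof -
  define r where "r = pmf (bind_pmf (replicate_pmf s P) T) v"
  have r: "2 / 3 \<le> r" "r \<le> 1"
    using assms by (simp_all add: r_def pmf_le_1)
  \<comment> \<open>The polynomial minus its value \<open>20 / 27\<close> at \<open>2 / 3\<close>,
    with that root divided out and the cofactor grouped to be visibly nonnegative.\<close>
  have "0 \<le> (r - 2 / 3) * (2 * r * (1 - r) + (10 / 9 - r / 3))"
    using r by (intro mult_nonneg_nonneg add_nonneg_nonneg) auto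
  also have "\<dots> = r\<^sup>2 * (3 - 2 * r) - 20 / 27"
    by (simp add: power2_eq_square field_simps)
  finally show ?thesis
    by (simp add: pmf_majority3 r_def)
qed

section \<open>Relabelling by a random permutation\<close>

lemma inj_on_extends_to_permutation:
  assumes X: "finite X" and A: "A \<subseteq> X" and f: "inj_on f A" "f ` A \<subseteq> X"
  obtains \<sigma> where "\<sigma> permutes X" "\<And>x. x \<in> A \<Longrightarrow> \<sigma> x = f x"
proof -
  have "card (X - A) = card (X - f ` A)"
    using assms by (simp add: card_Diff_subset finite_subset card_image)
  then obtain g where g: "bij_betw g (X - A) (X - f ` A)"
    using X finite_same_card_bij[of "X - A" "X - f ` A"] by auto
  define \<sigma> where "\<sigma> x = (if x \<in> A then f x else if x \<in> X then g x else x)" for x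
  have "bij_betw \<sigma> A (f ` A)"
    using f by (simp add: \<sigma>_def bij_betw_def inj_on_def)
  moreover have "bij_betw \<sigma> (X - A) (X - f ` A)"
    using g by (rule bij_betw_cong[THEN iffD1, rotated]) (simp add: \<sigma>_def)
  ultimately have "bij_betw \<sigma> (A \<union> (X - A)) (f ` A \<union> (X - f ` A))"
    by (rule bij_betw_combine) auto
  then have "bij_betw \<sigma> X X"
    using A f by (simp add: Un_absorb1)
  then have "\<sigma> permutes X"
    using A by (intro bij_imp_permutes) (auto simp: \<sigma>_def)
  then show thesis
    by (rule that) (simp add: \<sigma>_def)
qed

definition relabelled :: "'a set \<Rightarrow> ('a list \<Rightarrow> 'b pmf) \<Rightarrow> 'a list \<Rightarrow> 'b pmf" where
  "relabelled X V xs = bind_pmf (pmf_of_set {\<pi>. \<pi> permutes X}) (\<lambda>\<pi>. V (map \<pi> xs))"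

text \<open>Right translation by \<sigma> is a bijection of the finite group of permutations, hence
  preserves its uniform distribution.\<close>

lemma relabelled_map_permutation:
  assumes X: "finite X" and \<sigma>: "\<sigma> permutes X"
  shows "relabelled X V (map \<sigma> xs) = relabelled X V xs"
proof -
  let ?S = "{\<pi>. \<pi> permutes X}"
  have "inj_on (\<lambda>\<pi>. \<pi> \<circ> \<sigma>) ?S"
    using permutes_inv_o(1)[OF \<sigma>] by (intro inj_onI) (metis comp_assoc comp_id)
  moreover have "(\<lambda>\<pi>. \<pi> \<circ> \<sigma>) ` ?S \<subseteq> ?S"
    using \<sigma> by (auto intro: permutes_compose)
  ultimately have "bij_betw (\<lambda>\<pi>. \<pi> \<circ> \<sigma>) ?S ?S"
    using finite_permutations[OF X] by (simp add: bij_betw_def endo_inj_surj)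
  then have "map_pmf (\<lambda>\<pi>. \<pi> \<circ> \<sigma>) (pmf_of_set ?S) = pmf_of_set ?S"
    using finite_permutations[OF X] permutes_id[of X] by (intro map_pmf_of_set_bij_betw) blast+
  then have "relabelled X V xs = bind_pmf (map_pmf (\<lambda>\<pi>. \<pi> \<circ> \<sigma>) (pmf_of_set ?S)) (\<lambda>\<pi>. V (map \<pi> xs))"
    by (simp add: relabelled_def)
  then show ?thesis
    by (simp add: relabelled_def bind_map_pmf)
qed

text \<open>After a random relabelling only the pattern of equalities among the samples matters, so
  \<open>map f xs\<close> and \<open>map h xs\<close> become indistinguishable if \<open>f\<close> and \<open>h\<close> merge the same samples.\<close>

lemma relabelled_map_eq:
  assumes X: "finite X" and xs: "set xs \<subseteq> X" and f: "f \<in> X \<rightarrow> X" and h: "h \<in> X \<rightarrow> X"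
    and fh: "\<And>x. x \<in> X \<Longrightarrow> f (h x) = f x"
    and eq: "\<And>x y. x \<in> set xs \<Longrightarrow> y \<in> set xs \<Longrightarrow> f x = f y \<Longrightarrow> h x = h y"
  shows "relabelled X V (map f xs) = relabelled X V (map h xs)"
proof -
  \<comment> \<open>As \<open>f (h x) = f x\<close>, the map \<open>f\<close> itself carries
    \<open>map h xs\<close> to \<open>map f xs\<close>. It is injective on the entries because
    \<open>h\<close> merges all samples that \<open>f\<close> merges, so some permutation extends
    it.\<close>
  have "inj_on f (h ` set xs)"
  proof (rule inj_onI)
    fix a b assume "a \<in> h ` set xs" "b \<in> h ` set xs" "f a = f b"
    then obtain x y where "x \<in> set xs" "y \<in> set xs" "a = h x" "b = h y" by blast
    moreover from this have "x \<in> X" "y \<in> X" using xs by auto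
    ultimately show "a = b"
      using \<open>f a = f b\<close> fh eq by metis
  qed
  moreover have "h ` set xs \<subseteq> X" "f ` h ` set xs \<subseteq> X"
    using xs f h by auto
  ultimately obtain \<sigma> where \<sigma>: "\<sigma> permutes X" "\<And>x. x \<in> h ` set xs \<Longrightarrow> \<sigma> x = f x"
    using inj_on_extends_to_permutation[OF X] by blast
  have "f x = \<sigma> (h x)" if "x \<in> set xs" for x
    using \<sigma>(2)[of "h x"] fh[of x] xs that by auto
  then have "map f xs = map \<sigma> (map h xs)"
    by simp
  then show ?thesis
    by (simp only: relabelled_map_permutation[OF X \<sigma>(1)])
qed

lemma map_replicate_pmf: "map_pmf (map f) (replicate_pmf N P) = replicate_pmf N (map_pmf f P)"
proof (induction N)
  case (Suc N)
  then show ?case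
    by (simp add: map_bind_pmf bind_map_pmf Suc[symmetric])
qed simp

text \<open>With the permutation drawn first, \<open>V\<close> sees independent samples of a genuine
  distribution, so its guarantees apply for each \<pi> separately.\<close>

lemma bind_replicate_relabelled:
  "bind_pmf (replicate_pmf N P) (\<lambda>xs. relabelled X V (map h xs))
   = bind_pmf (pmf_of_set {\<pi>. \<pi> permutes X}) (\<lambda>\<pi>. bind_pmf (replicate_pmf N (map_pmf (\<pi> \<circ> h) P)) V)"
  unfolding relabelled_def
  by (subst bind_commute_pmf) (simp add: map_replicate_pmf[symmetric] bind_map_pmf)

section \<open>Non-adaptive queries and the decoding of their answers\<close>

fun ask :: "(nat \<times> nat) list \<Rightarrow> (bool list \<Rightarrow> bool) \<Rightarrow> query_alg" where
  "ask [] \<phi> = Verdict (\<phi> [])"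
| "ask ((i, j) # ps) \<phi> = Query i j (ask ps (\<lambda>bs. \<phi> (False # bs))) (ask ps (\<lambda>bs. \<phi> (True # bs)))"

lemma queries_ask [simp]: "queries (ask ps \<phi>) xs = ps"
  by (induction ps \<phi> rule: ask.induct) auto

lemma run_ask: "run (ask ps \<phi>) xs = \<phi> (map (\<lambda>(i, j). xs ! i ! j) ps)"
proof (induction ps \<phi> rule: ask.induct)
  case (2 i j ps \<phi>)
  then show ?case by (cases "xs ! i ! j") auto
qed auto

text \<open>Unqueried positions have no entry in the table and decode to \<open>False\<close>, just
  as under \<open>mask\<close>. A position drawn twice has two entries, with the same
  answer.\<close>

definition decode_answers :: "nat \<Rightarrow> nat \<Rightarrow> (nat \<times> nat) list \<Rightarrow> bool list \<Rightarrow> bool list list" where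
  "decode_answers n N ps bs =
     map (\<lambda>i. map (\<lambda>j. map_of (zip ps bs) (i, j) = Some True) [0..<n]) [0..<N]"

lemma decode_answers_product:
  assumes "xs \<in> sample_lists n N"
  shows "decode_answers n N (List.product [0..<N] js)
      (map (\<lambda>(i, j). xs ! i ! j) (List.product [0..<N] js)) = map (mask js) xs"
proof -
  have len: "length xs = N" "\<And>i. i < N \<Longrightarrow> length (xs ! i) = n"
    using assms by (force simp: sample_lists_def cube_def)+
  let ?ps = "List.product [0..<N] js"
  show ?thesis
  proof (rule nth_equalityI)
    show "length (decode_answers n N ?ps (map (\<lambda>(i, j). xs ! i ! j) ?ps)) = length (map (mask js) xs)"
      by (simp add: decode_answers_def len)
    fix i assume "i < length (decode_answers n N ?ps (map (\<lambda>(i, j). xs ! i ! j) ?ps))"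
    then have i: "i < N" by (simp add: decode_answers_def)
    have "map_of (zip ?ps (map (\<lambda>(i, j). xs ! i ! j) ?ps)) (i, j) = Some True
        \<longleftrightarrow> j \<in> set js \<and> xs ! i ! j" for j
      using i by (simp add: map_of_zip_map)
    then show "decode_answers n N ?ps (map (\<lambda>(i, j). xs ! i ! j) ?ps) ! i = map (mask js) xs ! i"
      using i by (simp add: decode_answers_def mask_def len)
  qed
qed

text \<open>A probabilistic machine tosses its coins before querying, so the verdict function
  \<open>\<phi>\<close> is drawn for all possible answers at once.\<close>

definition mask_machine ::
    "nat \<Rightarrow> nat \<Rightarrow> (bool list list \<Rightarrow> bool pmf) \<Rightarrow> nat list \<Rightarrow> query_alg pmf" where
  "mask_machine n N V js =
     map_pmf (\<lambda>\<phi>. ask (List.product [0..<N] js) (\<phi> \<circ> decode_answers n N (List.product [0..<N] js)))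
       (Pi_pmf (sample_lists n N) True V)"

lemma queries_mask_machine:
  "t \<in> set_pmf (mask_machine n N V js) \<Longrightarrow> queries t xs = List.product [0..<N] js"
  by (auto simp: mask_machine_def)

lemma finite_sample_lists: "finite (sample_lists n N)"
  using finite_lists_length_eq[OF finite_cube[of n], of N]
  by (simp add: sample_lists_def conj_commute)

lemma set_replicate_sample_lists:
  "P \<in> distributions n \<Longrightarrow> xs \<in> set_pmf (replicate_pmf N P) \<Longrightarrow> xs \<in> sample_lists n N"
  by (auto simp: set_replicate_pmf sample_lists_def distributions_def)

text \<open>For given samples the drawn function is evaluated only at
  \<open>map (mask js) xs\<close>. This argument lies in the index set of the product distribution,
  whose marginal there is \<open>V\<close>.\<close>

lemma bind_mask_machine:
  assumes P: "P \<in> distributions n"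
  shows "bind_pmf (mask_machine n N V js) (\<lambda>t. map_pmf (run t) (replicate_pmf N P))
    = bind_pmf (replicate_pmf N P) (\<lambda>xs. V (map (mask js) xs))"
proof -
  let ?\<Phi> = "Pi_pmf (sample_lists n N) True V"
  have "bind_pmf (mask_machine n N V js) (\<lambda>t. map_pmf (run t) (replicate_pmf N P))
      = bind_pmf (replicate_pmf N P) (\<lambda>xs. map_pmf (\<lambda>\<phi>. \<phi> (decode_answers n N (List.product [0..<N] js)
          (map (\<lambda>(i, j). xs ! i ! j) (List.product [0..<N] js)))) ?\<Phi>)"
    unfolding mask_machine_def bind_map_pmf map_pmf_def
    by (subst bind_commute_pmf) (simp add: run_ask bind_assoc_pmf bind_return_pmf)
  also have "\<dots> = bind_pmf (replicate_pmf N P) (\<lambda>xs. V (map (mask js) xs))"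
  proof (intro bind_pmf_cong refl)
    fix xs assume "xs \<in> set_pmf (replicate_pmf N P)"
    then have xs: "xs \<in> sample_lists n N"
      by (rule set_replicate_sample_lists[OF P])
    then have "map (mask js) xs \<in> sample_lists n N"
      by (auto simp: sample_lists_def mask_def cube_def)
    then show "map_pmf (\<lambda>\<phi>. \<phi> (decode_answers n N (List.product [0..<N] js)
          (map (\<lambda>(i, j). xs ! i ! j) (List.product [0..<N] js)))) ?\<Phi> = V (map (mask js) xs)"
      by (simp add: decode_answers_product[OF xs] Pi_pmf_component finite_sample_lists)
  qed
  finally show ?thesis .
qed

section \<open>Completeness and soundness of masking\<close>

lemma tv_dist_map_permutation:
  assumes "\<pi> permutes cube n"
  shows "tv_dist n (map_pmf \<pi> P) (map_pmf \<pi> Q) = tv_dist n P Q"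
proof -
  have inj: "pmf (map_pmf \<pi> R) (\<pi> x) = pmf R x" for R x
    by (rule pmf_map_inj'[OF permutes_inj[OF assms]])
  have "(\<Sum>x\<in>cube n. \<bar>pmf (map_pmf \<pi> P) x - pmf (map_pmf \<pi> Q) x\<bar>)
      = (\<Sum>x\<in>cube n. \<bar>pmf (map_pmf \<pi> P) (\<pi> x) - pmf (map_pmf \<pi> Q) (\<pi> x)\<bar>)"
    by (rule sum.reindex_bij_betw[OF permutes_imp_bij[OF assms], symmetric])
  then show ?thesis
    by (simp add: tv_dist_def inj)
qed

lemma set_pmf_permutations:
  "finite X \<Longrightarrow> set_pmf (pmf_of_set {\<pi>. \<pi> permutes X}) = {\<pi>. \<pi> permutes X}"
  using permutes_id[of X] by (intro set_pmf_of_set finite_permutations) blast+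

text \<open>The bound \<open>c\<close> is a parameter so that \<open>2 / 3\<close> gives
  completeness and \<open>1\<close> gives one-sided error.\<close>

lemma masked_complete:
  assumes closed: "closed_under_mapping n S" and P: "P \<in> S"
    and V: "\<And>Q. Q \<in> S \<Longrightarrow> c \<le> pmf (bind_pmf (replicate_pmf N Q) V) v" and c: "0 \<le> c" "c \<le> 1"
  shows "c \<le> pmf (bind_pmf (replicate_pmf N P) (\<lambda>xs. relabelled (cube n) V (map (mask js) xs))) v"
  unfolding bind_replicate_relabelled
proof (rule pmf_bind_ge[OF _ c])
  fix \<pi> assume "\<pi> \<in> set_pmf (pmf_of_set {\<pi>. \<pi> permutes cube n})"
  then have "\<pi> permutes cube n" by (simp add: set_pmf_permutations)
  then have "\<pi> \<circ> mask js \<in> cube n \<rightarrow> cube n"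
    using mask_cube[of js n] by (auto simp: permutes_in_image Pi_iff)
  then have "map_pmf (\<pi> \<circ> mask js) P \<in> S"
    using closed P unfolding closed_under_mapping_def by blast
  then show "c \<le> pmf (bind_pmf (replicate_pmf N (map_pmf (\<pi> \<circ> mask js) P)) V) v"
    by (rule V)
qed

text \<open>The masked samples are compared with the images under the map \<open>h\<close> that collapses the heavy
  fibres of the mask: \<open>h\<close> moves \<open>P\<close> only by \<open>\<epsilon>/2\<close>, so the image remains far, and it shows the
  same equality pattern unless two samples collide in a light fibre.\<close>

lemma masked_sound:
  assumes P: "P \<in> distributions n" and S: "S \<subseteq> distributions n" and closed: "closed_under_mapping n S"
    and far: "far_from (emd n) \<epsilon> P S"
    and V: "\<And>Q. Q \<in> distributions n \<Longrightarrow> far_from (tv_dist n) (\<epsilon> / 2) Q S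
      \<Longrightarrow> c \<le> pmf (bind_pmf (replicate_pmf N Q) V) v"
    and c: "0 \<le> c" "c \<le> 1" and \<tau>: "0 < \<tau>" and \<epsilon>: "0 < \<epsilon>"
    and few: "far_collisions n (\<epsilon> / 4) P js \<le> \<epsilon> / 4 * \<tau>"
  shows "c \<le> pmf (bind_pmf (replicate_pmf N P) (\<lambda>xs. relabelled (cube n) V (map (mask js) xs))) v
    + real N ^ 2 * \<tau>"
proof -
  have irrefl: "\<not> \<epsilon> / 4 < rel_hamming n x x" for x
    using \<epsilon> by simp
  obtain h where h: "h \<in> cube n \<rightarrow> cube n" "\<And>x. x \<in> cube n \<Longrightarrow> mask js (h x) = mask js x"
    and heavy: "\<And>x y. \<tau> \<le> (\<Sum>x'\<in>{x'\<in>cube n. mask js x' = mask js x}. pmf P x')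
      \<Longrightarrow> mask js x = mask js y \<Longrightarrow> h x = h y"
    and moved: "(\<Sum>x\<in>cube n. if \<epsilon> / 4 < rel_hamming n x (h x) then pmf P x else 0)
      \<le> far_collisions n (\<epsilon> / 4) P js / \<tau>"
    using ex_representatives[of "cube n" "pmf P" "\<lambda>x y. \<epsilon> / 4 < rel_hamming n x y" \<tau> "mask js",
        OF finite_cube pmf_nonneg irrefl \<tau>, folded far_collisions_def] by blast
  \<comment> \<open>Displacements up to \<epsilon>/4 are charged to the whole mass, larger ones cost
    at most \<open>1\<close> on the mass moved that far. By \<open>few\<close>, this second part is
    again at most \<epsilon>/4.\<close>
  have "(\<Sum>x\<in>cube n. pmf P x * rel_hamming n x (h x))
      \<le> (\<Sum>x\<in>cube n. pmf P x * (\<epsilon> / 4) + (if \<epsilon> / 4 < rel_hamming n x (h x) then pmf P x else 0))"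
  proof (rule sum_mono)
    fix x
    show "pmf P x * rel_hamming n x (h x)
        \<le> pmf P x * (\<epsilon> / 4) + (if \<epsilon> / 4 < rel_hamming n x (h x) then pmf P x else 0)"
    proof (cases "\<epsilon> / 4 < rel_hamming n x (h x)")
      case True
      have "pmf P x * rel_hamming n x (h x) \<le> pmf P x * 1"
        by (intro mult_left_mono rel_hamming_le_1) simp
      moreover have "0 \<le> pmf P x * (\<epsilon> / 4)" using \<epsilon> by simp
      ultimately show ?thesis using True by simp
    next
      case False
      then have "pmf P x * rel_hamming n x (h x) \<le> pmf P x * (\<epsilon> / 4)"
        by (intro mult_left_mono) auto
      then show ?thesis using False by simp
    qed
  qed
  also have "\<dots> = \<epsilon> / 4 + (\<Sum>x\<in>cube n. if \<epsilon> / 4 < rel_hamming n x (h x) then pmf P x else 0)"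
    unfolding sum.distrib sum_distrib_right[symmetric] sum_pmf_cube[OF P] by simp
  also have "\<dots> \<le> \<epsilon> / 4 + far_collisions n (\<epsilon> / 4) P js / \<tau>"
    using moved by simp
  also have "\<dots> \<le> \<epsilon> / 2"
    using few \<tau> by (simp add: field_simps)
  finally have cost: "(\<Sum>x\<in>cube n. pmf P x * rel_hamming n x (h x)) \<le> \<epsilon> / 2" .
  \<comment> \<open>Relabelling does not bring the distribution closer to \<open>S\<close>: a member
    \<open>Q\<close> is pulled back along \<open>inv \<pi>\<close>, which stays in \<open>S\<close>
    by closure and preserves total variation distance.\<close>
  have far': "far_from (tv_dist n) (\<epsilon> / 2) (map_pmf (\<pi> \<circ> h) P) S" if \<pi>: "\<pi> permutes cube n" for \<pi>
    unfolding far_from_def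
  proof
    fix Q assume Q: "Q \<in> S"
    have inv: "inv \<pi> permutes cube n" by (rule permutes_inv[OF \<pi>])
    then have "inv \<pi> \<in> cube n \<rightarrow> cube n"
      by (auto simp: permutes_in_image)
    then have Q': "map_pmf (inv \<pi>) Q \<in> S"
      using closed Q unfolding closed_under_mapping_def by blast
    have "\<epsilon> < emd n P (map_pmf (inv \<pi>) Q)"
      using far Q' by (simp add: far_from_def)
    also have "\<dots> \<le> (\<Sum>x\<in>cube n. pmf P x * rel_hamming n x (h x))
        + tv_dist n (map_pmf h P) (map_pmf (inv \<pi>) Q)"
      using Q' S by (intro emd_le_map_tv P h) auto
    also have "tv_dist n (map_pmf h P) (map_pmf (inv \<pi>) Q)
        = tv_dist n (map_pmf (\<pi> \<circ> h) P) (map_pmf (\<pi> \<circ> inv \<pi>) Q)"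
      by (simp only: tv_dist_map_permutation[OF \<pi>] pmf.map_comp[symmetric])
    finally show "\<epsilon> / 2 < tv_dist n (map_pmf (\<pi> \<circ> h) P) Q"
      using cost by (simp add: permutes_inv_o[OF \<pi>] pmf.map_id)
  qed
  have "c \<le> pmf (bind_pmf (replicate_pmf N P) (\<lambda>xs. relabelled (cube n) V (map h xs))) v"
    unfolding bind_replicate_relabelled
  proof (rule pmf_bind_ge[OF _ c])
    fix \<pi> assume "\<pi> \<in> set_pmf (pmf_of_set {\<pi>. \<pi> permutes cube n})"
    then have \<pi>: "\<pi> permutes cube n" by (simp add: set_pmf_permutations)
    have "map_pmf (\<pi> \<circ> h) P \<in> distributions n"
      using h(1) \<pi> by (intro map_distributions P) (auto simp: permutes_in_image Pi_iff)
    then show "c \<le> pmf (bind_pmf (replicate_pmf N (map_pmf (\<pi> \<circ> h) P)) V) v"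
      by (rule V[OF _ far'[OF \<pi>]])
  qed
  also have "\<dots> \<le> pmf (bind_pmf (replicate_pmf N P) (\<lambda>xs. relabelled (cube n) V (map (mask js) xs))) v
      + measure_pmf.prob (replicate_pmf N P)
          {xs. \<exists>x\<in>set xs. \<exists>y\<in>set xs. mask js x = mask js y \<and> h x \<noteq> h y}"
  proof (rule pmf_bind_le_except)
    fix xs
    assume "xs \<in> set_pmf (replicate_pmf N P)"
      and ok: "xs \<notin> {xs. \<exists>x\<in>set xs. \<exists>y\<in>set xs. mask js x = mask js y \<and> h x \<noteq> h y}"
    then have "set xs \<subseteq> cube n"
      using set_replicate_sample_lists[OF P, of xs N] by (simp add: sample_lists_def)
    then have "relabelled (cube n) V (map (mask js) xs) = relabelled (cube n) V (map h xs)"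
      by (rule relabelled_map_eq[OF finite_cube _ mask_cube h]) (use ok in blast)+
    then show "pmf (relabelled (cube n) V (map h xs)) v \<le> pmf (relabelled (cube n) V (map (mask js) xs)) v"
      by simp
  qed
  also have "measure_pmf.prob (replicate_pmf N P)
      {xs. \<exists>x\<in>set xs. \<exists>y\<in>set xs. mask js x = mask js y \<and> h x \<noteq> h y} \<le> real N ^ 2 * \<tau>"
  proof (rule prob_replicate_clash)
    fix x
    let ?m = "\<Sum>x'\<in>{x'\<in>cube n. mask js x' = mask js x}. pmf P x'"
    show "measure_pmf.prob P {y. mask js x = mask js y \<and> h x \<noteq> h y} \<le> \<tau>"
    \<comment> \<open>A heavy fibre is merged by \<open>h\<close> and admits no clash; in a light
      one, a clash requires a second sample in a fibre of mass below \<tau>.\<close>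
    proof (cases "\<tau> \<le> ?m")
      case True
      then have empty: "{y. mask js x = mask js y \<and> h x \<noteq> h y} = {}"
        using heavy by blast
      show ?thesis
        unfolding empty using \<tau> by simp
    next
      case False
      have "measure_pmf.prob P {y. mask js x = mask js y \<and> h x \<noteq> h y}
          = measure_pmf.prob P ({y. mask js x = mask js y \<and> h x \<noteq> h y} \<inter> set_pmf P)"
        by (rule measure_Int_set_pmf[symmetric])
      also have "\<dots> \<le> measure_pmf.prob P {x'\<in>cube n. mask js x' = mask js x}"
        using P by (intro measure_pmf.finite_measure_mono) (auto simp: distributions_def)
      also have "\<dots> = ?m"
        by (simp add: measure_measure_pmf_finite)
      finally show ?thesis using False by simp
    qed
  next
    fix x y
    assume "mask js x = mask js y \<and> h x \<noteq> h y"
    then show "mask js y = mask js x \<and> h y \<noteq> h x"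
      by metis
  qed (use \<tau> in simp_all)
  finally show ?thesis by simp
qed

text \<open>As \<open>32400 = 30 * 4 * 270\<close>, the right-hand side is \<theta>/30 for the
  threshold \<theta> of \<open>mask_tester_sound\<close>. From \<open>\<epsilon> < 1 / 2\<close> and
  \<open>s \<ge> 1\<close> follows \<open>L \<ge> ln 2\<close>, so the logarithm absorbs constants:
  \<open>32400 \<le> 2 ^ 15\<close> leads to \<open>15 * L + 2 * L = 17 * L\<close>, and the
  \<open>4\<close> in \<epsilon>/4 turns \<open>17\<close> into \<open>68\<close>.\<close>

lemma power_num_positions_le:
  assumes \<epsilon>: "0 < \<epsilon>" "\<epsilon> < 1 / 2" and s: "s \<ge> 1" and m: "68 * (1 / \<epsilon>) * ln (s / \<epsilon>) \<le> real m"
  shows "(1 - \<epsilon> / 4) ^ m \<le> \<epsilon> / (32400 * s\<^sup>2)"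
proof -
  define L where "L = ln (s / \<epsilon>)"
  have "2 * \<epsilon> \<le> s" using \<epsilon> s by simp
  then have L: "ln 2 \<le> L"
    using \<epsilon> s by (simp add: L_def field_simps)
  have "ln (32400 * s\<^sup>2 / \<epsilon>) \<le> ln (2 ^ 15 * (s / \<epsilon>) ^ 2)"
  proof (rule ln_mono)
    have "32400 * s\<^sup>2 / \<epsilon> \<le> 2 ^ 15 * s\<^sup>2 / \<epsilon>"
      using \<epsilon> by (simp add: divide_right_mono)
    also have "\<dots> \<le> 2 ^ 15 * s\<^sup>2 / \<epsilon>\<^sup>2"
      using \<epsilon> s by (intro divide_left_mono) (auto simp: power2_eq_square)
    finally show "32400 * s\<^sup>2 / \<epsilon> \<le> 2 ^ 15 * (s / \<epsilon>) ^ 2"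
      by (simp add: power_divide)
    show "0 < 32400 * s\<^sup>2 / \<epsilon>"
      using \<epsilon> s by simp
  qed
  also have "\<dots> = 15 * ln 2 + 2 * L"
  proof -
    have "ln (2 ^ 15 * (s / \<epsilon>) ^ 2) = ln (2 ^ 15) + ln ((s / \<epsilon>) ^ 2)"
      using \<epsilon> s by (intro ln_mult_pos) auto
    also have "\<dots> = real 15 * ln 2 + real 2 * L"
      unfolding L_def ln_realpow ..
    finally show ?thesis by simp
  qed
  also have "\<dots> \<le> 17 * L"
    using L by simp
  also have "\<dots> \<le> \<epsilon> / 4 * real m"
    using m \<epsilon> by (simp add: L_def field_simps)
  finally have bound: "ln (32400 * s\<^sup>2 / \<epsilon>) \<le> \<epsilon> / 4 * real m" .
  have "(1 - \<epsilon> / 4) ^ m \<le> exp (- (\<epsilon> / 4)) ^ m"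
    using exp_ge_add_one_self[of "- (\<epsilon> / 4)"] \<epsilon> by (intro power_mono) auto
  also have "\<dots> = exp (- (\<epsilon> / 4 * real m))"
    by (simp add: exp_of_nat_mult[symmetric] mult.commute)
  also have "\<dots> \<le> exp (- ln (32400 * s\<^sup>2 / \<epsilon>))"
    using bound by simp
  also have "\<dots> = \<epsilon> / (32400 * s\<^sup>2)"
    using \<epsilon> s by (simp add: exp_minus)
  finally show ?thesis .
qed

text \<open>Bad masks and collisions in light fibres cost \<open>1/30\<close> each, and \<open>20/27 - 2/30 > 2/3\<close>.\<close>

lemma mask_tester_sound:
  assumes n: "n \<ge> 1" and P: "P \<in> distributions n" and S: "S \<subseteq> distributions n"
    and closed: "closed_under_mapping n S" and far: "far_from (emd n) \<epsilon> P S"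
    and V: "\<And>Q. Q \<in> distributions n \<Longrightarrow> far_from (tv_dist n) (\<epsilon> / 2) Q S
      \<Longrightarrow> 20 / 27 \<le> pmf (bind_pmf (replicate_pmf (3 * s) Q) V) v"
    and \<epsilon>: "0 < \<epsilon>" "\<epsilon> < 1 / 2" and s: "s \<ge> 1"
    and m: "68 * (1 / \<epsilon>) * ln (real s / \<epsilon>) \<le> real m"
  shows "2 / 3 \<le> pmf (bind_pmf (replicate_pmf m (pmf_of_set {..<n})) (\<lambda>js.
    bind_pmf (replicate_pmf (3 * s) P) (\<lambda>xs. relabelled (cube n) V (map (mask js) xs)))) v"
proof -
  \<comment> \<open>Chosen so that \<open>(3 * s) ^ 2 * \<tau> = 1 / 30\<close>; then \<theta> is
    the largest collision weight that \<open>masked_sound\<close> tolerates.\<close>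
  define \<tau> where "\<tau> = 1 / (270 * (real s)\<^sup>2)"
  define \<theta> where "\<theta> = \<epsilon> / 4 * \<tau>"
  let ?J = "replicate_pmf m (pmf_of_set {..<n})"
  have \<tau>: "0 < \<tau>" and \<theta>: "0 < \<theta>"
    using s \<epsilon> by (simp_all add: \<tau>_def \<theta>_def)
  have clash: "real (3 * s) ^ 2 * \<tau> = 1 / 30"
    using s by (simp add: \<tau>_def power2_eq_square)
  have "(1 - \<epsilon> / 4) ^ m \<le> \<epsilon> / (32400 * (real s)\<^sup>2)"
    using s m by (intro power_num_positions_le \<epsilon>) simp_all
  also have "\<dots> = 1 / 30 * \<theta>"
    by (simp add: \<theta>_def \<tau>_def)
  finally have "(1 - \<epsilon> / 4) ^ m / \<theta> \<le> 1 / 30"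
    using \<theta> by (simp add: divide_le_eq)
  then have bad: "measure_pmf.prob ?J {js. \<theta> \<le> far_collisions n (\<epsilon> / 4) P js} \<le> 1 / 30"
    using prob_far_collisions_le[OF n P _ _ \<theta>, of "\<epsilon> / 4" m] \<epsilon> by linarith
  have "20 / 27 - 1 / 30 \<le> pmf (bind_pmf ?J (\<lambda>js.
      bind_pmf (replicate_pmf (3 * s) P) (\<lambda>xs. relabelled (cube n) V (map (mask js) xs)))) v
      + measure_pmf.prob ?J {js. \<theta> \<le> far_collisions n (\<epsilon> / 4) P js}"
  proof (rule pmf_bind_ge_except)
    fix js assume "js \<notin> {js. \<theta> \<le> far_collisions n (\<epsilon> / 4) P js}"
    then show "20 / 27 - 1 / 30 \<le> pmf (bind_pmf (replicate_pmf (3 * s) P)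
        (\<lambda>xs. relabelled (cube n) V (map (mask js) xs))) v"
      using masked_sound[OF P S closed far V _ _ \<tau>, where js = js] \<epsilon> clash by (simp add: \<theta>_def)
  qed auto
  then show ?thesis
    using bad by simp
qed

text \<open>Constant maps put every point mass on the cube into a nonempty closed property, and P is
  within \<open>1 / 2\<close> of the all-ones or the all-zeros string.\<close>

lemma far_from_bound:
  assumes n: "n \<ge> 1" and P: "P \<in> distributions n" and closed: "closed_under_mapping n S"
    and ne: "S \<noteq> {}" and S: "S \<subseteq> distributions n" and far: "far_from (emd n) \<epsilon> P S"
  shows "\<epsilon> < 1 / 2"
proof -
  obtain b where b: "emd n P (return_pmf (replicate n b)) \<le> 1 / 2"
    using emd_constant_string_le_half[OF P n] .
  obtain X where X: "X \<in> S" using ne by blast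
  have "(\<lambda>_. replicate n b) \<in> cube n \<rightarrow> cube n"
    by (auto simp: cube_def)
  then have "map_pmf (\<lambda>_. replicate n b) X \<in> S"
    using closed X unfolding closed_under_mapping_def by blast
  then show ?thesis
    using far b by (auto simp: far_from_def map_pmf_const)
qed

section \<open>The tester\<close>

definition num_positions :: "real \<Rightarrow> nat \<Rightarrow> nat" where
  "num_positions \<epsilon> s = (if \<epsilon> < 1 / 2 \<and> s \<ge> 1 then nat \<lceil>68 * (1 / \<epsilon>) * ln (real s / \<epsilon>)\<rceil> else 0)"

lemma num_positions_ge:
  assumes "\<epsilon> < 1 / 2" "s \<ge> 1"
  shows "68 * (1 / \<epsilon>) * ln (real s / \<epsilon>) \<le> real (num_positions \<epsilon> s)"
  using assms by (simp add: num_positions_def) linarith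

lemma ln_ratio_nonneg:
  assumes "0 < \<epsilon>" "\<epsilon> \<le> 1"
  shows "0 \<le> ln (real s / \<epsilon>)"
  \<comment> \<open>For \<open>s = 0\<close> the ratio is \<open>0\<close>, and \<open>ln 0\<close>
    is \<open>0\<close> by convention.\<close>
  using assms by (cases "s = 0") auto

text \<open>Rounding up adds at most \<open>1\<close>, which is at most
  \<open>(1 / \<epsilon>) * ln (s / \<epsilon>)\<close> in the nontrivial case; the step from
  \<open>68\<close> to \<open>70\<close> absorbs it.\<close>

lemma num_positions_le:
  assumes \<epsilon>: "0 < \<epsilon>" "\<epsilon> \<le> 1"
  shows "real (num_positions \<epsilon> s) \<le> 70 * (1 / \<epsilon>) * ln (real s / \<epsilon>)"
proof (cases "\<epsilon> < 1 / 2 \<and> s \<ge> 1")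
  case True
  then have "2 * \<epsilon> \<le> real s" using \<epsilon> by linarith
  then have "ln 2 \<le> ln (real s / \<epsilon>)"
    using \<epsilon> True by (simp add: field_simps)
  then have "1 / 2 \<le> ln (real s / \<epsilon>)"
    using ln2_ge_two_thirds by linarith
  moreover have "2 \<le> 1 / \<epsilon>"
    using True \<epsilon> by (simp add: field_simps)
  ultimately have "2 * (1 / 2) \<le> (1 / \<epsilon>) * ln (real s / \<epsilon>)"
    using \<epsilon> by (intro mult_mono) auto
  then show ?thesis
    using True by (simp add: num_positions_def) linarith
next
  case False
  have "0 \<le> 70 * (1 / \<epsilon>) * ln (real s / \<epsilon>)"
    using \<epsilon> ln_ratio_nonneg[OF \<epsilon>] by simp
  then show ?thesis
    using False by (auto simp: num_positions_def)
qed

text \<open>For \<open>\<epsilon> \<ge> 1/2\<close> no distribution is far from a nonempty property, and for \<open>s = 0\<close> the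
  verdict of the given tester is independent of the distribution. In both cases, in which the
  logarithm may vanish, no queries are needed.\<close>

definition mask_tester_coins ::
    "(nat \<Rightarrow> bool list pmf set) \<Rightarrow> (nat \<Rightarrow> real \<Rightarrow> nat) \<Rightarrow> std_machine \<Rightarrow>
     nat \<Rightarrow> real \<Rightarrow> nat list \<Rightarrow> query_alg pmf" where
  "mask_tester_coins D s T n \<epsilon> =
     (if \<epsilon> < 1 / 2 \<and> s n (\<epsilon> / 2) \<ge> 1
      then mask_machine n (3 * s n (\<epsilon> / 2))
        (relabelled (cube n) (majority3 (s n (\<epsilon> / 2)) (T n (\<epsilon> / 2))))
      else (\<lambda>_. return_pmf (Verdict (D n \<noteq> {}))))"

text \<open>The positions are drawn before and apart from all other coins, which is the shape that
  \<open>same_uniform_queries\<close> demands.\<close>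

definition mask_tester ::
    "(nat \<Rightarrow> bool list pmf set) \<Rightarrow> (nat \<Rightarrow> real \<Rightarrow> nat) \<Rightarrow> std_machine \<Rightarrow> doho_machine" where
  "mask_tester D s T n \<epsilon> =
     bind_pmf (replicate_pmf (num_positions \<epsilon> (s n (\<epsilon> / 2))) (pmf_of_set {..<n}))
       (mask_tester_coins D s T n \<epsilon>)"

lemma product_Nil2 [simp]: "List.product xs [] = []"
  by (induction xs) auto

text \<open>This covers the trivial branch too: there \<open>num_positions\<close> is
  \<open>0\<close>, hence \<open>js\<close> and the product are empty, matching a bare
  \<open>Verdict\<close>.\<close>

lemma queries_mask_tester:
  assumes "js \<in> set_pmf (replicate_pmf (num_positions \<epsilon> (s n (\<epsilon> / 2))) (pmf_of_set {..<n}))"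
    and "t \<in> set_pmf (mask_tester_coins D s T n \<epsilon> js)"
  shows "queries t xs = List.product [0..<3 * s n (\<epsilon> / 2)] js"
  using assms
  by (auto simp: mask_tester_coins_def num_positions_def set_replicate_pmf queries_mask_machine
      split: if_splits)

lemma doho_output_mask_tester:
  assumes P: "P \<in> distributions n" and nontrivial: "\<epsilon> < 1 / 2" "s n (\<epsilon> / 2) \<ge> 1"
  shows "doho_output (mask_tester D s T) n \<epsilon> (3 * s n (\<epsilon> / 2)) P =
    bind_pmf (replicate_pmf (num_positions \<epsilon> (s n (\<epsilon> / 2))) (pmf_of_set {..<n})) (\<lambda>js.
      bind_pmf (replicate_pmf (3 * s n (\<epsilon> / 2)) P) (\<lambda>xs.
        relabelled (cube n) (majority3 (s n (\<epsilon> / 2)) (T n (\<epsilon> / 2))) (map (mask js) xs)))"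
  using nontrivial by (simp add: doho_output_def mask_tester_def mask_tester_coins_def bind_assoc_pmf bind_mask_machine[OF P])

lemma doho_output_mask_tester_trivial:
  assumes "\<not> (\<epsilon> < 1 / 2 \<and> s n (\<epsilon> / 2) \<ge> 1)"
  shows "doho_output (mask_tester D s T) n \<epsilon> N P = return_pmf (D n \<noteq> {})"
proof -
  have "run (Verdict b) = (\<lambda>_. b)" for b
    by auto
  then show ?thesis
    using assms by (auto simp: doho_output_def mask_tester_def mask_tester_coins_def bind_return_pmf map_pmf_const)
qed

lemma mask_tester_accepts:
  assumes D: "D n \<subseteq> distributions n" and closed: "closed_under_mapping n (D n)" and P: "P \<in> D n"
    and c: "0 \<le> c" "c \<le> 1"
    and maj: "\<And>Q. Q \<in> D n \<Longrightarrow> c \<le> pmf (bind_pmf (replicate_pmf (3 * s n (\<epsilon> / 2)) Q)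
      (majority3 (s n (\<epsilon> / 2)) (T n (\<epsilon> / 2)))) True"
  shows "c \<le> pmf (doho_output (mask_tester D s T) n \<epsilon> (3 * s n (\<epsilon> / 2)) P) True"
proof (cases "\<epsilon> < 1 / 2 \<and> s n (\<epsilon> / 2) \<ge> 1")
  case True
  have P': "P \<in> distributions n" using P D by blast
  show ?thesis
    unfolding doho_output_mask_tester[where s = s, OF P' conjunct1[OF True] conjunct2[OF True]]
    by (rule pmf_bind_ge[OF _ c], rule masked_complete[OF closed P maj c])
next
  case False
  then show ?thesis
    using P c by (auto simp: doho_output_mask_tester_trivial indicator_def)
qed

lemma mask_tester_rejects:
  assumes n: "n \<ge> 1" and \<epsilon>: "0 < \<epsilon>" "\<epsilon> \<le> 1" and D: "D n \<subseteq> distributions n"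
    and closed: "closed_under_mapping n (D n)" and T: "std_tester D s T"
    and P: "P \<in> distributions n" and far: "far_from (emd n) \<epsilon> P (D n)"
  shows "2 / 3 \<le> pmf (doho_output (mask_tester D s T) n \<epsilon> (3 * s n (\<epsilon> / 2)) P) False"
proof -
  have rej: "2 / 3 \<le> pmf (bind_pmf (replicate_pmf (s n (\<epsilon> / 2)) Q) (T n (\<epsilon> / 2))) False"
    if "Q \<in> distributions n" "far_from (tv_dist n) (\<epsilon> / 2) Q (D n)" for Q
    using T n \<epsilon> that unfolding std_tester_def std_output_def by simp
  show ?thesis
  proof (cases "\<epsilon> < 1 / 2 \<and> s n (\<epsilon> / 2) \<ge> 1")
    case True
    then have half: "\<epsilon> < 1 / 2" and s: "s n (\<epsilon> / 2) \<ge> 1" by auto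
    show ?thesis
      unfolding doho_output_mask_tester[where s = s, OF P half s]
      by (rule mask_tester_sound[OF n P D closed far pmf_majority3_ge[OF rej] \<epsilon>(1) half s
            num_positions_ge[OF half s]])
  next
    case False
    \<comment> \<open>Otherwise \<open>s n (\<epsilon> / 2) = 0\<close>, and the one verdict
      distribution on the empty sample list would have to accept a member of \<open>D n\<close> and
      reject \<open>P\<close>, each with probability at least \<open>2 / 3\<close>.\<close>
    have "D n = {}"
    proof (rule ccontr)
      assume ne: "D n \<noteq> {}"
    have half: "\<epsilon> < 1 / 2"
      by (rule far_from_bound[OF n P closed ne D far])
    then have 0: "s n (\<epsilon> / 2) = 0"
      using False by simp
      obtain X where X: "X \<in> D n" using ne by blast
      then have "2 / 3 \<le> pmf (std_output T n (\<epsilon> / 2) (s n (\<epsilon> / 2)) X) True"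
        using T n \<epsilon> D unfolding std_tester_def by auto
      moreover have "far_from (tv_dist n) (\<epsilon> / 2) P (D n)"
        unfolding far_from_def
      proof
        fix Q assume Q: "Q \<in> D n"
        then have "\<epsilon> < emd n P Q"
          using far by (simp add: far_from_def)
        also have "\<dots> \<le> tv_dist n P Q"
          using Q D by (intro emd_le_tv P) auto
        finally show "\<epsilon> / 2 < tv_dist n P Q" using \<epsilon> by simp
      qed
      then have "2 / 3 \<le> pmf (bind_pmf (replicate_pmf (s n (\<epsilon> / 2)) P) (T n (\<epsilon> / 2))) False"
        by (rule rej[OF P])
      moreover have "pmf (T n (\<epsilon> / 2) []) True + pmf (T n (\<epsilon> / 2) []) False = 1"
        using sum_pmf_eq_1[OF finite subset_UNIV, of "T n (\<epsilon> / 2) []"] by (simp add: UNIV_bool add.commute)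
      ultimately show False
        by (simp add: 0 std_output_def bind_return_pmf)
    qed
    then show ?thesis
      using False by (simp add: doho_output_mask_tester_trivial)
  qed
qed

theorem theorem2p2:
  shows "\<exists>(C::real) (k::nat). C > 0 \<and>
    (\<forall>(D :: nat \<Rightarrow> bool list pmf set) (s :: nat \<Rightarrow> real \<Rightarrow> nat) (T :: std_machine).
       distribution_property D \<longrightarrow> (\<forall>n\<ge>1. closed_under_mapping n (D n)) \<longrightarrow> std_tester D s T \<longrightarrow>
       (\<exists>(A :: doho_machine) (q :: nat \<Rightarrow> real \<Rightarrow> nat) (m :: nat \<Rightarrow> real \<Rightarrow> nat).
          doho_tester D (\<lambda>n \<epsilon>. 3 * s n (\<epsilon>/2)) q A \<and>
          (\<forall>n\<ge>1. \<forall>\<epsilon>\<in>{0<..1}.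
             real (q n \<epsilon>) \<le> C * (real (s n (\<epsilon>/2)) / \<epsilon>) * ln (real (s n (\<epsilon>/2)) / \<epsilon>) ^ k \<and>
             real (m n \<epsilon>) \<le> C * (1 / \<epsilon>) * ln (real (s n (\<epsilon>/2)) / \<epsilon>) \<and>
             same_uniform_queries n (3 * s n (\<epsilon>/2)) (m n \<epsilon>) (A n \<epsilon>)) \<and>
          (std_one_sided D s T \<longrightarrow> doho_one_sided D (\<lambda>n \<epsilon>. 3 * s n (\<epsilon>/2)) A)))"
\<comment> \<open>\<open>210 = 3 * 70\<close>: each of the \<open>3 * s\<close> samples is queried
  at no more than \<open>70 * (1 / \<epsilon>) * ln (s / \<epsilon>)\<close> positions. A single
  logarithmic factor appears, so \<open>k = 1\<close>.\<close>
proof (intro exI[of _ "210 :: real"] exI[of _ "1 :: nat"] conjI allI impI)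
  fix D :: "nat \<Rightarrow> bool list pmf set" and s :: "nat \<Rightarrow> real \<Rightarrow> nat" and T :: std_machine
  assume "distribution_property D" and closed: "\<forall>n\<ge>1. closed_under_mapping n (D n)" and T: "std_tester D s T"
  then have D: "D n \<subseteq> distributions n" if "n \<ge> 1" for n
    using that by (simp add: distribution_property_def)
  let ?A = "mask_tester D s T"
  let ?m = "\<lambda>n \<epsilon>. num_positions \<epsilon> (s n (\<epsilon> / 2))"
  let ?q = "\<lambda>n \<epsilon>. 3 * s n (\<epsilon> / 2) * ?m n \<epsilon>"
  have tester: "doho_tester D (\<lambda>n \<epsilon>. 3 * s n (\<epsilon> / 2)) ?q ?A"
    unfolding doho_tester_def
  proof (intro allI impI ballI conjI)
    fix n :: nat and \<epsilon> :: real
    assume n: "n \<ge> 1" and \<epsilon>: "\<epsilon> \<in> {0<..1}"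
    {
      fix t xs assume "t \<in> set_pmf (?A n \<epsilon>)"
      then obtain js where js: "js \<in> set_pmf (replicate_pmf (?m n \<epsilon>) (pmf_of_set {..<n}))"
        and qs: "queries t xs = List.product [0..<3 * s n (\<epsilon> / 2)] js"
        unfolding mask_tester_def set_bind_pmf using queries_mask_tester by blast
      have "set js \<subseteq> {..<n}" "length js = ?m n \<epsilon>"
        using js n by (auto simp: set_replicate_pmf lessThan_empty_iff)
      then show "set (queries t xs) \<subseteq> {..<3 * s n (\<epsilon> / 2)} \<times> {..<n}"
        and "length (queries t xs) \<le> ?q n \<epsilon>"
        by (auto simp: qs)
    }
    {
      fix P assume P: "P \<in> D n"
      show "2 / 3 \<le> pmf (doho_output ?A n \<epsilon> (3 * s n (\<epsilon> / 2)) P) True"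
      proof (rule mask_tester_accepts[where D = D and s = s and T = T, OF D[OF n] _ P])
        fix Q assume "Q \<in> D n"
        then have "2 / 3 \<le> pmf (bind_pmf (replicate_pmf (s n (\<epsilon> / 2)) Q) (T n (\<epsilon> / 2))) True"
          using T n \<epsilon> D[OF n] unfolding std_tester_def std_output_def by auto
        then show "2 / 3 \<le> pmf (bind_pmf (replicate_pmf (3 * s n (\<epsilon> / 2)) Q)
            (majority3 (s n (\<epsilon> / 2)) (T n (\<epsilon> / 2)))) True"
          using pmf_majority3_ge by fastforce
      qed (use closed n in auto)
    }
    fix P assume "P \<in> distributions n" "far_from (emd n) \<epsilon> P (D n)"
    then show "2 / 3 \<le> pmf (doho_output ?A n \<epsilon> (3 * s n (\<epsilon> / 2)) P) False"
      using mask_tester_rejects[where s = s, OF n _ _ D[OF n] _ T] \<epsilon> closed n by auto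
  qed
  have one_sided: "doho_one_sided D (\<lambda>n \<epsilon>. 3 * s n (\<epsilon> / 2)) ?A" if one: "std_one_sided D s T"
    unfolding doho_one_sided_def
  proof (intro allI impI ballI)
    fix n :: nat and \<epsilon> :: real and P
    assume n: "n \<ge> 1" and \<epsilon>: "\<epsilon> \<in> {0<..1}" and "P \<in> D n"
    have "1 \<le> pmf (doho_output ?A n \<epsilon> (3 * s n (\<epsilon> / 2)) P) True"
    proof (rule mask_tester_accepts[where D = D and s = s and T = T, OF D[OF n] _ \<open>P \<in> D n\<close>])
      fix Q assume "Q \<in> D n"
      then have "pmf (bind_pmf (replicate_pmf (s n (\<epsilon> / 2)) Q) (T n (\<epsilon> / 2))) True = 1"
        using one n \<epsilon> unfolding std_one_sided_def std_output_def by auto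
      then show "1 \<le> pmf (bind_pmf (replicate_pmf (3 * s n (\<epsilon> / 2)) Q)
          (majority3 (s n (\<epsilon> / 2)) (T n (\<epsilon> / 2)))) True"
        by (simp add: pmf_majority3)
    qed (use closed n in auto)
    then show "pmf (doho_output ?A n \<epsilon> (3 * s n (\<epsilon> / 2)) P) True = 1"
      using pmf_le_1 by (intro antisym)
  qed
  have bounds: "real (?q n \<epsilon>) \<le> 210 * (real (s n (\<epsilon> / 2)) / \<epsilon>) * ln (real (s n (\<epsilon> / 2)) / \<epsilon>) ^ 1"
    "real (?m n \<epsilon>) \<le> 210 * (1 / \<epsilon>) * ln (real (s n (\<epsilon> / 2)) / \<epsilon>)" if \<epsilon>: "\<epsilon> \<in> {0<..1}" for n \<epsilon>
  proof -
    let ?s = "s n (\<epsilon> / 2)"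
    have m: "real (?m n \<epsilon>) \<le> 70 * (1 / \<epsilon>) * ln (real ?s / \<epsilon>)"
      using \<epsilon> by (intro num_positions_le) auto
    have "0 \<le> 1 / \<epsilon> * ln (real ?s / \<epsilon>)"
      using \<epsilon> ln_ratio_nonneg[of \<epsilon> ?s] by simp
    then show "real (?m n \<epsilon>) \<le> 210 * (1 / \<epsilon>) * ln (real ?s / \<epsilon>)"
      using m by simp
    have "real (3 * ?s) * real (?m n \<epsilon>) \<le> real (3 * ?s) * (70 * (1 / \<epsilon>) * ln (real ?s / \<epsilon>))"
      using m by (rule mult_left_mono) simp
    then show "real (?q n \<epsilon>) \<le> 210 * (real ?s / \<epsilon>) * ln (real ?s / \<epsilon>) ^ 1"
      by (simp add: algebra_simps)
  qed
  have uniform: "same_uniform_queries n (3 * s n (\<epsilon> / 2)) (?m n \<epsilon>) (?A n \<epsilon>)" for n \<epsilon>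
    unfolding same_uniform_queries_def mask_tester_def
    by (intro exI[of _ "mask_tester_coins D s T n \<epsilon>"] conjI refl ballI arg_cong[where f = mset])
      (rule queries_mask_tester)
  show "\<exists>(A :: doho_machine) (q :: nat \<Rightarrow> real \<Rightarrow> nat) (m :: nat \<Rightarrow> real \<Rightarrow> nat).
          doho_tester D (\<lambda>n \<epsilon>. 3 * s n (\<epsilon>/2)) q A \<and>
          (\<forall>n\<ge>1. \<forall>\<epsilon>\<in>{0<..1}.
             real (q n \<epsilon>) \<le> 210 * (real (s n (\<epsilon>/2)) / \<epsilon>) * ln (real (s n (\<epsilon>/2)) / \<epsilon>) ^ 1 \<and>
             real (m n \<epsilon>) \<le> 210 * (1 / \<epsilon>) * ln (real (s n (\<epsilon>/2)) / \<epsilon>) \<and>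
             same_uniform_queries n (3 * s n (\<epsilon>/2)) (m n \<epsilon>) (A n \<epsilon>)) \<and>
          (std_one_sided D s T \<longrightarrow> doho_one_sided D (\<lambda>n \<epsilon>. 3 * s n (\<epsilon>/2)) A)"
    by (intro exI[of _ ?A] exI[of _ ?q] exI[of _ ?m] conjI allI ballI impI tester one_sided bounds uniform)
qed simp

end
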